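(* Let $G(z)=\sum_{i=1}^n\frac{r_i}{z-p_i}$ have distinct poles $p_1,\dots,p_n$ and let $2\le k\le n$. If $G(z)$ is Toeplitz $k$-positive, then $$G(z)=\frac{z}{z-p_1}\,G_r(z),$$ where $G_r(z)$ is Toeplitz $(k-1)$-positive, and all real zeros of $G(z)$ are smaller than $p_{\min\{k,n\}}$.
   Context: A system is a nonzero, strictly proper, real rational transfer function $G(z)=\sum_{t\ge 1} g(t)z^{-t}$ whose poles and zeros are disjoint (so all residues $r_i$ above are nonzero) and whose impulse response $g$ is bounded; set $g(t)=0$ for $t\le 0$. Poles (possibly complex, in conjugate pairs) are ordered by descending absolute value, $|p_1|\ge|p_2|\ge\dots\ge|p_n|$, ties being subsorted by decreasing real part. For $t\ge0$, $j\ge1$, $T_g(t,j)\in\mathbb{R}^{j\times j}$ is the Toeplitz matrix with $(a,b)$ entry $g(t+a-b)$. A matrix is $k$-positive if all its $j$-minors are nonnegative for $1\le j\le k$. A system with impulse response $g$ is Toeplitz $k$-positive if $T_g(0,N)$ is $k$-positive for all $N\ge k$. *)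

theory Defs
  imports Complex_Main
    "HOL-Computational_Algebra.Computational_Algebra"
    "HOL-Computational_Algebra.Field_as_Ring"
    "Jordan_Normal_Form.Determinant"
    "Jordan_Normal_Form.DL_Submatrix"
begin

text \<open>
  A real rational transfer function is an element of the field of fractions of the real
  polynomials; \<open>quot_of_fract\<close> is its reduced representation (coprime numerator and
  denominator, monic denominator).
\<close>

type_synonym transfer_function = "real poly fract"

definition tf_num :: "transfer_function \<Rightarrow> complex poly" where
  "tf_num G = map_poly complex_of_real (fst (quot_of_fract G))"

definition tf_den :: "transfer_function \<Rightarrow> complex poly" where
  "tf_den G = map_poly complex_of_real (snd (quot_of_fract G))"

definition tf_eval :: "transfer_function \<Rightarrow> complex \<Rightarrow> complex" where
  "tf_eval G z = poly (tf_num G) z / poly (tf_den G) z"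

definition tf_poles :: "transfer_function \<Rightarrow> complex set" where
  "tf_poles G = {z. poly (tf_den G) z = 0}"

definition tf_zeros :: "transfer_function \<Rightarrow> complex set" where
  "tf_zeros G = {z. poly (tf_num G) z = 0}"

definition strictly_proper :: "transfer_function \<Rightarrow> bool" where
  "strictly_proper G \<longleftrightarrow> degree (tf_num G) < degree (tf_den G)"

definition has_impulse_response :: "transfer_function \<Rightarrow> (int \<Rightarrow> real) \<Rightarrow> bool" where
  "has_impulse_response G g \<longleftrightarrow>
     (\<forall>t\<le>0. g t = 0) \<and>
     (\<forall>\<^sub>F z in at_infinity.
        (\<lambda>t. complex_of_real (g (int (Suc t))) / z ^ Suc t) sums tf_eval G z)"

text \<open>
  In the reduced representation the disjointness of poles and zeros holds automatically
  (see \<open>tf_poles_zeros_disjoint\<close> below).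
\<close>

definition is_system :: "transfer_function \<Rightarrow> bool" where
  "is_system G \<longleftrightarrow>
     G \<noteq> 0 \<and> strictly_proper G \<and> tf_poles G \<inter> tf_zeros G = {} \<and>
     (\<exists>g. has_impulse_response G g \<and> (\<exists>B. \<forall>t. \<bar>g t\<bar> \<le> B))"

definition toeplitz_mat :: "(int \<Rightarrow> real) \<Rightarrow> nat \<Rightarrow> nat \<Rightarrow> real mat" where
  "toeplitz_mat g t j = mat j j (\<lambda>(a, b). g (int t + int a - int b))"

definition k_positive_mat :: "nat \<Rightarrow> real mat \<Rightarrow> bool" where
  "k_positive_mat k A \<longleftrightarrow>
     (\<forall>j\<in>{1..k}. \<forall>I J. I \<subseteq> {..<dim_row A} \<and> J \<subseteq> {..<dim_col A} \<and> card I = j \<and> card J = j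
        \<longrightarrow> 0 \<le> det (submatrix A I J))"

text \<open>
  The impulse response is unique (\<open>has_impulse_response_unique\<close> below), so the
  existential quantifier only names it.
\<close>

definition toeplitz_k_positive :: "nat \<Rightarrow> transfer_function \<Rightarrow> bool" where
  "toeplitz_k_positive k G \<longleftrightarrow>
     (\<exists>g. has_impulse_response G g \<and> (\<forall>N\<ge>k. k_positive_mat k (toeplitz_mat g 0 N)))"

lemma poly_map_of_real_hom:
  "map_poly complex_of_real (p * q) = map_poly complex_of_real p * map_poly complex_of_real q"
  "map_poly complex_of_real (p + q) = map_poly complex_of_real p + map_poly complex_of_real q"
  by (rule poly_eqI, simp add: coeff_map_poly coeff_mult)+

lemma tf_poles_zeros_disjoint: "tf_poles G \<inter> tf_zeros G = {}"
proof -
  define a b where "a = fst (quot_of_fract G)" and "b = snd (quot_of_fract G)"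
  have "coprime a b"
    using coprime_quot_of_fract[of G] by (simp add: a_def b_def)
  then obtain u v where "u * a + v * b = 1"
    using bezout_coefficients_fst_snd[of a b] by (metis coprime_imp_gcd_eq_1)
  then have "map_poly complex_of_real u * tf_num G + map_poly complex_of_real v * tf_den G = 1"
    unfolding tf_num_def tf_den_def a_def [symmetric] b_def [symmetric]
    by (metis poly_map_of_real_hom map_poly_1' of_real_1)
  then have "poly (map_poly complex_of_real u) z * poly (tf_num G) z
      + poly (map_poly complex_of_real v) z * poly (tf_den G) z = 1" for z
    by (metis poly_1 poly_add poly_mult)
  then show ?thesis
    unfolding tf_poles_def tf_zeros_def by (auto simp: set_eq_iff) (metis add_0 mult_zero_right zero_neq_one)
qed

lemma has_impulse_response_unique:
  assumes "has_impulse_response G g" "has_impulse_response G h"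
  shows "g = h"
proof -
  define c where "c t = complex_of_real (g (int (Suc t)) - h (int (Suc t)))" for t
  have "\<forall>\<^sub>F z in at_infinity. (\<lambda>t. c t / z ^ Suc t) sums 0"
  proof (rule eventually_elim2)
    show "\<forall>\<^sub>F z in at_infinity.
        (\<lambda>t. complex_of_real (g (int (Suc t))) / z ^ Suc t) sums tf_eval G z"
      and "\<forall>\<^sub>F z in at_infinity.
        (\<lambda>t. complex_of_real (h (int (Suc t))) / z ^ Suc t) sums tf_eval G z"
      using assms by (simp_all add: has_impulse_response_def)
  qed (drule (1) sums_diff, simp add: c_def diff_divide_distrib)
  then obtain R where R: "\<And>z. norm z \<ge> R \<Longrightarrow> (\<lambda>t. c t / z ^ Suc t) sums 0"
    unfolding eventually_at_infinity by blast
  define s where "s = 1 / (\<bar>R\<bar> + 1)"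
  have s: "s > 0" by (simp add: s_def add_pos_nonneg add.commute)
  have pw: "(\<lambda>t. c t * w ^ t) sums 0" if "w \<noteq> 0" "norm w < s" for w
  proof -
    have "R \<le> \<bar>R\<bar> + 1" by simp
    also have "\<dots> \<le> 1 / norm w" using that by (simp add: s_def field_simps)
    finally have "(\<lambda>t. c t / (1 / w) ^ Suc t) sums 0"
      by (intro R) (simp add: norm_divide)
    then have "(\<lambda>t. (c t * w ^ t) * w) sums (0 * w)"
      by (simp add: power_divide mult_ac)
    then show ?thesis using that by (subst (asm) sums_mult2_iff) auto
  qed
  have "c t = 0" for t
  proof (induction t rule: less_induct)
    case (less t)
    have sh: "(\<lambda>m. c (m + t) * w ^ m) sums 0" if "w \<noteq> 0" "norm w < s" for w
    proof -
      have "(\<lambda>m. c (m + t) * w ^ (m + t)) sums 0"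
        using pw[OF that] less by (subst sums_iff_shift) simp
      then have "(\<lambda>m. (c (m + t) * w ^ m) * w ^ t) sums (0 * w ^ t)"
        by (simp add: power_add mult_ac)
      then show ?thesis using that by (subst (asm) sums_mult2_iff) auto
    qed
    have "((\<lambda>w::complex. 0 :: complex) \<longlongrightarrow> c (0 + t)) (at 0)"
      using powser_limit_0_strong[OF s, of "\<lambda>m. c (m + t)" "\<lambda>w. 0"] sh by simp
    then show ?case
      using tendsto_const_iff[of "at (0::complex)" 0 "c t"] by simp
  qed
  then have eq: "g (int (Suc t)) = h (int (Suc t))" for t
    by (simp add: c_def flip: of_real_diff)
  show ?thesis
  proof
    fix t show "g t = h t"
    proof (cases "t \<le> 0")
      case True
      then show ?thesis using assms by (simp add: has_impulse_response_def)
    next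
      case False
      then have "t = int (Suc (nat (t - 1)))" by simp
      then show ?thesis using eq by metis
    qed
  qed
qed

end

theory Submission
  imports Defs
begin

text \<open>
  Toeplitz \<open>k\<close>-positivity says that all minors of order at most \<open>k\<close> of the infinite matrix
  \<open>g (i - l)\<close> are nonnegative. Nonnegativity of \<open>g\<close> makes the leading pole \<open>p\<^sub>1\<close> positive (Cesaro means),
  and the minors of order two, i.e. log-concavity, give \<open>g t \<ge> p\<^sub>1 g (t - 1)\<close>, which forces \<open>p\<^sub>1\<close> to
  dominate the other poles strictly. Hence \<open>g t / p\<^sub>1 ^ t\<close> has a positive limit, and a minor
  of order \<open>j + 1\<close> whose last row moves to infinity degenerates to a minor of order \<open>j\<close> of the deflated
  sequence \<open>g t - p\<^sub>1 g (t - 1)\<close>, at least on consecutive columns; a perturbed form of Fekete's criterion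
  extends this to all columns. So deflation, which is multiplication of \<open>G\<close> by \<open>(z - p\<^sub>1) / z\<close>,
  lowers the order of positivity by one. After \<open>k - 1\<close> deflations the sequence is still nonnegative
  and nonzero and has leading pole \<open>p\<^sub>k\<close>. Thus \<open>p\<^sub>k\<close> is real, and the transfer function has
  no zero \<open>x > p\<^sub>k\<close>, where its series converges to a positive value.
\<close>

section \<open>Minors given by index maps, Laplace expansions and a Pluecker relation\<close>

text \<open>Index maps instead of index sets allow repeated and replaced rows, so linearity and
  vanishing by repetition can be stated. Only values below \<open>j\<close> matter.\<close>

definition minor :: "(nat \<Rightarrow> nat \<Rightarrow> 'a::comm_ring_1) \<Rightarrow> nat \<Rightarrow> (nat \<Rightarrow> nat) \<Rightarrow> (nat \<Rightarrow> nat) \<Rightarrow> 'a" where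
  "minor A j f g = det (mat j j (\<lambda>(a, b). A (f a) (g b)))"

definition skip :: "nat \<Rightarrow> nat \<Rightarrow> nat" where
  "skip q b = (if b < q then b else Suc b)"

lemma minor_cong:
  assumes "\<And>a b. a < j \<Longrightarrow> b < j \<Longrightarrow> A (f a) (g b) = B (f' a) (g' b)"
  shows "minor A j f g = minor B j f' g'"
  unfolding minor_def by (rule arg_cong[where f = det], rule eq_matI) (use assms in auto)

lemma minor_0 [simp]: "minor A 0 f g = 1"
  by (simp add: minor_def det_dim_zero)

lemma mat_delete_mat:
  "mat_delete (mat (Suc j) (Suc j) (\<lambda>(a, b). h a b)) i q = mat j j (\<lambda>(a, b). h (skip i a) (skip q b))"
  unfolding mat_delete_def by (rule eq_matI) (auto simp: skip_def)

lemma minor_expand_col: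
  assumes "q \<le> j"
  shows "minor A (Suc j) f g
    = (\<Sum>a\<le>j. (-1) ^ (a + q) * minor A j (f \<circ> skip a) (g \<circ> skip q) * A (f a) (g q))"
  unfolding minor_def
  by (subst laplace_expansion_column[of _ "Suc j" q])
     (use assms in \<open>auto simp: cofactor_def mat_delete_mat mult_ac lessThan_Suc_atMost intro!: sum.cong\<close>)

lemma minor_expand_row:
  assumes "q \<le> j"
  shows "minor A (Suc j) f g
    = (\<Sum>b\<le>j. (-1) ^ (q + b) * minor A j (f \<circ> skip q) (g \<circ> skip b) * A (f q) (g b))"
  unfolding minor_def
  by (subst laplace_expansion_row[of _ "Suc j" q])
     (use assms in \<open>auto simp: cofactor_def mat_delete_mat mult_ac lessThan_Suc_atMost intro!: sum.cong\<close>)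

lemma minor_eq_rows:
  assumes "i < j" "i' < j" "i \<noteq> i'" "f i = f i'"
  shows "minor A j f g = 0"
  unfolding minor_def
  by (rule det_identical_rows[of _ j i i']) (use assms in \<open>auto simp: row_def\<close>)

lemma minor_eq_cols:
  assumes "i < j" "i' < j" "i \<noteq> i'" "g i = g i'"
  shows "minor A j f g = 0"
  unfolding minor_def
  by (rule det_identical_columns[of _ j i i']) (use assms in \<open>auto simp: col_def\<close>)

text \<open>Repeating row \<open>f a\<close> on top of the \<open>m\<close> rows gives a minor of
  order \<open>m + 1\<close> with two equal rows; this is its expansion along the top row.\<close>

lemma minor_relation:
  assumes "a < m"
  shows "(\<Sum>c\<le>m. (-1) ^ c * minor A m f (g \<circ> skip c) * A (f a) (g c)) = 0"
proof -
  define f' where "f' i = (if i = 0 then f a else f (i - 1))" for i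
  have "minor A (Suc m) f' g = 0"
    by (rule minor_eq_rows[of 0 _ "Suc a"]) (use assms in \<open>auto simp: f'_def\<close>)
  moreover have "minor A m (f' \<circ> skip 0) h = minor A m f h" for h
    by (rule minor_cong) (auto simp: f'_def skip_def)
  ultimately show ?thesis
    by (simp add: minor_expand_row[of 0] f'_def)
qed

text \<open>A Pluecker relation: the relations \<open>minor_relation\<close> between the \<open>n + 3\<close> columns, summed over the
  rows with the cofactors of the \<open>n\<close> columns common to all minors, involve only the other three.\<close>

lemma minor_three_term:
  fixes A :: "nat \<Rightarrow> nat \<Rightarrow> 'a::comm_ring_1"
  assumes "1 \<le> q" "q \<le> Suc n"
  shows "minor A (n + 2) f (g \<circ> skip q) * minor A (Suc n) f (g \<circ> Suc)
    = minor A (n + 2) f (g \<circ> skip 0) * minor A (Suc n) f (g \<circ> skip q)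
    + minor A (n + 2) f (g \<circ> skip (n + 2)) * minor A (Suc n) f (g \<circ> skip q \<circ> Suc)"
proof -
  \<comment> \<open>\<open>w\<close> lists the common columns, at positions \<open>1..n + 1\<close>
    without \<open>q\<close>; the three others are at \<open>0\<close>, \<open>q\<close> and
    \<open>n + 2\<close>.\<close>
  define w where "w = g \<circ> skip q \<circ> Suc"
  define K where "K i = (-1) ^ i * minor A n (f \<circ> skip i) w" for i
  define D where "D c = minor A (n + 2) f (g \<circ> skip c)" for c
  define E where "E c = (\<Sum>i\<le>n. K i * A (f i) (g c))" for c
  have "(\<Sum>c\<le>n + 2. (-1) ^ c * D c * E c)
      = (\<Sum>c\<le>n + 2. \<Sum>i\<le>n. K i * ((-1) ^ c * D c * A (f i) (g c)))"
    unfolding E_def sum_distrib_left by (intro sum.cong refl) (simp only: mult_ac)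
  also have "\<dots> = (\<Sum>i\<le>n. K i * (\<Sum>c\<le>n + 2. (-1) ^ c * D c * A (f i) (g c)))"
    by (subst sum.swap) (simp only: sum_distrib_left)
  also have "\<dots> = 0"
    unfolding D_def by (intro sum.neutral ballI) (subst minor_relation, auto)
  finally have 0: "(\<Sum>c\<le>n + 2. (-1) ^ c * D c * E c) = 0" .
  \<comment> \<open>Up to sign, \<open>E c\<close> is the minor with column \<open>c\<close>
    inserted among the columns \<open>w\<close> at any position \<open>r\<close>.\<close>
  have ins: "E c = (-1) ^ r * minor A (Suc n) f h"
    if "r \<le> n" "h r = g c" "\<And>b. b < n \<Longrightarrow> h (skip r b) = w b" for c r h
  proof -
    have "minor A n (f \<circ> skip i) (h \<circ> skip r) = minor A n (f \<circ> skip i) w" for i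
      by (rule minor_cong) (use that in auto)
    moreover have "(-1) ^ r * ((-1) ^ (i + r) * x * y) = (-1) ^ i * x * y" for i and x y :: 'a
    proof -
      have "(-1) ^ r * ((-1) ^ (i + r) * x * y) = ((-1) ^ r * (-1) ^ r) * ((-1) ^ i * x * y)"
        by (simp only: power_add mult_ac)
      then show ?thesis by (simp flip: power_mult_distrib)
    qed
    ultimately show ?thesis
      using that(1,2) by (simp add: minor_expand_col[of r] E_def K_def sum_distrib_left)
  qed
  have E0: "E 0 = minor A (Suc n) f (g \<circ> skip q)"
    using ins[of 0 "g \<circ> skip q" 0] assms by (simp add: w_def skip_def)
  have Eq: "E q = (-1) ^ (q - 1) * minor A (Suc n) f (g \<circ> Suc)"
    by (rule ins) (use assms in \<open>auto simp: w_def skip_def\<close>)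
  have Ez: "E (n + 2) = (-1) ^ n * minor A (Suc n) f (g \<circ> skip q \<circ> Suc)"
    by (rule ins) (use assms in \<open>auto simp: w_def skip_def\<close>)
  \<comment> \<open>A column already in \<open>w\<close> would occur twice.\<close>
  have Ew: "E c = 0" if "c \<le> n + 2" "c \<notin> {0, q, n + 2}" for c
  proof -
    define h where "h b = (if b = 0 then g c else w (b - 1))" for b
    note c = that
    obtain b where b: "b < n" "w b = g c"
    proof (cases "c < q")
      case True
      then show thesis using c assms by (intro that[of "c - 1"]) (auto simp: w_def skip_def)
    next
      case False
      then show thesis using c assms
        by (intro that[of "c - 2"]) (auto simp: w_def skip_def intro!: arg_cong[where f = g])
    qed
    have "E c = (-1) ^ 0 * minor A (Suc n) f h"
      by (rule ins) (auto simp: h_def skip_def)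
    also have "minor A (Suc n) f h = 0"
      by (rule minor_eq_cols[of 0 _ "Suc b"]) (use b in \<open>auto simp: h_def\<close>)
    finally show ?thesis by simp
  qed
  have "(\<Sum>c\<le>n + 2. (-1) ^ c * D c * E c) = (\<Sum>c\<in>{0, q, n + 2}. (-1) ^ c * D c * E c)"
    by (rule sum.mono_neutral_right) (use assms Ew in auto)
  also have "\<dots> = D 0 * E 0 + (-1) ^ q * D q * E q + (-1) ^ (n + 2) * D (n + 2) * E (n + 2)"
    using assms by (simp add: add_ac)
  also have "\<dots> = D 0 * minor A (Suc n) f (g \<circ> skip q) - D q * minor A (Suc n) f (g \<circ> Suc)
      + D (n + 2) * minor A (Suc n) f (g \<circ> skip q \<circ> Suc)"
  proof -
    have 1: "(-1) ^ q * (-1) ^ (q - 1) = (-1::'a)"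
      using assms by (cases q) (auto simp flip: power_mult_distrib)
    have 2: "(-1) ^ (n + 2) * (-1) ^ n = (1::'a)"
      by (simp flip: power_mult_distrib)
    have 3: "u * x * (v * y) = (u * v) * (x * y)" for u v x y :: 'a
      by (simp only: mult_ac)
    have "(-1) ^ q * D q * E q = - (D q * minor A (Suc n) f (g \<circ> Suc))"
      unfolding Eq by (subst 3, subst 1) simp
    moreover have "(-1) ^ (n + 2) * D (n + 2) * E (n + 2)
        = D (n + 2) * minor A (Suc n) f (g \<circ> skip q \<circ> Suc)"
      unfolding Ez by (subst 3, subst 2) simp
    ultimately show ?thesis by (simp add: E0)
  qed
  finally show ?thesis using 0 by (simp add: D_def algebra_simps)
qed

section \<open>Increasing index maps and Fekete's criterion for positive minors\<close>

definition incr :: "nat \<Rightarrow> nat \<Rightarrow> (nat \<Rightarrow> nat) \<Rightarrow> bool" where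
  "incr j N f \<longleftrightarrow> strict_mono_on {..<j} f \<and> f ` {..<j} \<subseteq> {..<N}"

lemma incr_less: "incr j N f \<Longrightarrow> a < b \<Longrightarrow> b < j \<Longrightarrow> f a < f b"
  unfolding incr_def strict_mono_on_def by auto

lemma incr_bound: "incr j N f \<Longrightarrow> a < j \<Longrightarrow> f a < N"
  unfolding incr_def by auto

lemma incrI:
  assumes "\<And>a b. a < b \<Longrightarrow> b < j \<Longrightarrow> f a < f b" "\<And>a. a < j \<Longrightarrow> f a < N"
  shows "incr j N f"
  using assms unfolding incr_def strict_mono_on_def by auto

lemma incr_comp:
  assumes "incr m N f" "\<And>a b. a < b \<Longrightarrow> h a < h b" "\<And>a. a < j \<Longrightarrow> h a < m"
  shows "incr j N (f \<circ> h)"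
  using assms by (intro incrI) (auto intro: incr_less incr_bound)

lemma incr_skip: "incr (Suc j) N f \<Longrightarrow> incr j N (f \<circ> skip q)"
  by (rule incr_comp) (auto simp: skip_def)

lemma incr_shift: "l + j \<le> M \<Longrightarrow> incr j M (\<lambda>b. l + b)"
  by (rule incrI) auto

lemma incr_inj: "incr j N f \<Longrightarrow> a < j \<Longrightarrow> b < j \<Longrightarrow> f a = f b \<Longrightarrow> a = b"
  by (metis incr_less less_irrefl linorder_neqE_nat)

lemma incr_ge:
  assumes "incr j N f" "a < j"
  shows "a \<le> f a"
  using assms(2)
proof (induction a)
  case (Suc a)
  then show ?case using incr_less[OF assms(1), of a "Suc a"] by auto
qed auto

text \<open>Fekete's criterion: the three-term relation fills the gaps in the column set.\<close>

lemma fekete_strict: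
  fixes A :: "nat \<Rightarrow> nat \<Rightarrow> 'a::linordered_idom"
  assumes pos: "\<And>j f l. j \<le> k \<Longrightarrow> incr j N f \<Longrightarrow> l + j \<le> M \<Longrightarrow> minor A j f (\<lambda>b. l + b) > 0"
    and "j \<le> k" "incr j N f" "incr j M g"
  shows "minor A j f g > 0"
  using assms(2-4)
proof (induction j arbitrary: f g rule: less_induct)
  case (less j)
  \<comment> \<open>The inner induction is on the spread of the columns, within the outer one on the
    order.\<close>
  from less.prems(3) show ?case
  proof (induction "g (j - 1) - g 0" arbitrary: g rule: less_induct)
    case (less g)
    note g = less.prems
    show ?case
    proof (cases "\<forall>q. 1 \<le> q \<and> q < j \<longrightarrow> g q = Suc (g (q - 1))")
      case True
      have *: "g b = g 0 + b" if "b < j" for b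
        using that
      proof (induction b)
        case (Suc b)
        then show ?case using True[rule_format, of "Suc b"] by simp
      qed auto
      have "minor A j f g = minor A j f (\<lambda>b. g 0 + b)"
        by (rule minor_cong) (simp flip: *)
      moreover have "g 0 + j \<le> M" if "j > 0"
        using *[of "j - 1"] incr_bound[OF g, of "j - 1"] that by auto
      ultimately show ?thesis
        using pos[OF \<open>j \<le> k\<close> \<open>incr j N f\<close>] by (cases "j = 0") auto
    next
      case False
      then obtain q where q: "1 \<le> q" "q < j" "g q \<noteq> Suc (g (q - 1))" by blast
      have gap: "Suc (g (q - 1)) < g q"
        using q incr_less[OF g, of "q - 1" q] by auto
      define n where "n = j - 2"
      have j: "j = n + 2" using q by (auto simp: n_def)
      \<comment> \<open>\<open>g'\<close> inserts a column just after \<open>g (q - 1)\<close>,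
        inside the gap. Omitting position \<open>q\<close> gives back \<open>g\<close>, omitting
        either end narrows the spread, and the other minors of the relation have lower
        order.\<close>
      define g' where "g' b = (if b < q then g b else if b = q then Suc (g (q - 1)) else g (b - 1))" for b
      have g': "incr (n + 3) M g'"
      proof (rule incrI)
        fix a b assume ab: "a < b" "b < n + 3"
        have mono: "g x \<le> g y" if "x \<le> y" "y < j" for x y
          using incr_less[OF g, of x y] that by (cases "x = y") auto
        consider "b < q" | "b = q" | "a < q" "b > q" | "a = q" | "a > q" using ab by linarith
        then show "g' a < g' b"
        proof cases
          case 1 then show ?thesis using ab q incr_less[OF g, of a b] by (auto simp: g'_def)
        next
          case 2 then show ?thesis using ab q mono[of a "q - 1"] by (simp add: g'_def less_Suc_eq_le)
        next
          case 3 then show ?thesis using ab q j incr_less[OF g, of a "b - 1"] by (auto simp: g'_def)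
        next
          case 4
          then have "g q \<le> g (b - 1)" using ab q j by (intro mono) auto
          then show ?thesis using 4 ab gap by (auto simp: g'_def)
        next
          case 5 then show ?thesis using ab q j incr_less[OF g, of "a - 1" "b - 1"] by (auto simp: g'_def)
        qed
      next
        fix a assume "a < n + 3"
        then show "g' a < M"
          using q gap j incr_bound[OF g, of a] incr_bound[OF g, of "a - 1"] incr_bound[OF g, of q]
          by (auto simp: g'_def)
      qed
      have last: "g' (n + 2) = g (n + 1)" and first: "g' 0 = g 0"
        using q j by (auto simp: g'_def)
      have 1: "minor A (n + 2) f (g' \<circ> skip 0) > 0"
        using incr_less[OF g', of 0 1] incr_less[OF g', of 1 "n + 2"] incr_skip[of "n + 2" M g' 0] g' last first
        by (subst j[symmetric], intro less.hyps) (auto simp: skip_def j numeral_3_eq_3)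
      have 2: "minor A (n + 2) f (g' \<circ> skip (n + 2)) > 0"
        using incr_less[OF g', of 0 "n + 1"] incr_less[OF g', of "n + 1" "n + 2"] incr_skip[of "n + 2" M g' "n + 2"] g' last first
        by (subst j[symmetric], intro less.hyps) (auto simp: skip_def j numeral_3_eq_3)
      have sm: "minor A (Suc n) f h > 0" if "incr (Suc n) M h" for h
        using less.prems \<open>j \<le> k\<close> \<open>incr j N f\<close> that incr_comp[of j N f id "Suc n"] j
        by (intro less.IH) auto
      have 3: "minor A (Suc n) f (g' \<circ> Suc) > 0" "minor A (Suc n) f (g' \<circ> skip q) > 0"
          "minor A (Suc n) f (g' \<circ> skip q \<circ> Suc) > 0"
        using q j by (auto simp: comp_assoc intro!: sm incr_comp[OF g'] simp: skip_def)
      have "minor A (n + 2) f (g' \<circ> skip q) * minor A (Suc n) f (g' \<circ> Suc) > 0"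
        using q j 1 2 3 by (subst minor_three_term) (auto intro!: add_pos_pos mult_pos_pos)
      moreover have "minor A (n + 2) f (g' \<circ> skip q) = minor A j f g"
        unfolding j by (rule minor_cong) (use q in \<open>auto simp: g'_def skip_def\<close>)
      ultimately show ?thesis using 3(1) by (simp add: zero_less_mult_iff)
    qed
  qed
qed

section \<open>Fekete's criterion for nonnegative minors, by perturbation\<close>

text \<open>The least index off the identity can be lowered by one without hitting its predecessor,
  so unit moves lead from any increasing map down to \<open>id\<close>; the index sum
  decreases.\<close>

lemma incr_move_down:
  assumes ext: "\<And>f f'. (\<And>a. a < j \<Longrightarrow> f a = f' a) \<Longrightarrow> P f \<Longrightarrow> P f'"
    and down: "\<And>f a v. incr j N f \<Longrightarrow> P f \<Longrightarrow> a < j \<Longrightarrow> incr j N (f(a := v)) \<Longrightarrow> f a = Suc v \<Longrightarrow> P (f(a := v))"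
    and "incr j N f" "P f"
  shows "P id"
  using assms(3,4)
proof (induction "\<Sum>a<j. f a" arbitrary: f rule: less_induct)
  case (less f)
  show ?case
  proof (cases "\<forall>a<j. f a = a")
    case True
    then show ?thesis using less.prems ext[of f id] by auto
  next
    case False
    define a where "a = (LEAST a. a < j \<and> f a \<noteq> a)"
    have a: "a < j" "f a \<noteq> a"
      using False LeastI_ex[of "\<lambda>a. a < j \<and> f a \<noteq> a"] by (auto simp: a_def)
    have below: "f b = b" if "b < a" for b
      using that a not_less_Least[of b "\<lambda>a. a < j \<and> f a \<noteq> a"] by (auto simp: a_def)
    have fa: "f a > a" using incr_ge[OF less.prems(1) a(1)] a by auto
    let ?f = "f(a := f a - 1)"
    have inc: "incr j N ?f"
    proof (rule incrI)
      fix b c assume bc: "b < c" "c < j"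
      then show "?f b < ?f c"
        using incr_less[OF less.prems(1) bc] fa below[of b] by auto
    next
      fix b assume "b < j"
      then show "?f b < N" using incr_bound[OF less.prems(1), of b] by auto
    qed
    have "P ?f" using down[OF less.prems a(1) inc] fa by auto
    moreover have "(\<Sum>b<j. ?f b) < (\<Sum>b<j. f b)"
      by (rule sum_strict_mono_ex1) (use a fa in auto)
    ultimately show ?thesis using less.hyps inc by blast
  qed
qed

text \<open>Both maps descend to \<open>id\<close>. Unit moves are reversible, so failure of
  \<open>P\<close> also travels downwards, and \<open>P\<close> and its failure would meet at
  \<open>id\<close>.\<close>

lemma incr_connected:
  assumes ext: "\<And>f f'. (\<And>a. a < j \<Longrightarrow> f a = f' a) \<Longrightarrow> P f \<Longrightarrow> P f'"
    and move: "\<And>f a v. incr j N f \<Longrightarrow> P f \<Longrightarrow> a < j \<Longrightarrow> incr j N (f(a := v)) \<Longrightarrow>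
      f a = Suc v \<or> v = Suc (f a) \<Longrightarrow> P (f(a := v))"
    and f: "incr j N f" "P f" and f': "incr j N f'"
  shows "P f'"
proof (rule ccontr)
  assume "\<not> P f'"
  have "P id"
    by (rule incr_move_down[where P = P and f = f and j = j and N = N]) (fact ext, use move in blast, fact f(1), fact f(2))
  moreover have "\<not> P id"
  proof (rule incr_move_down[where P = "\<lambda>f. \<not> P f" and f = f' and j = j and N = N])
    show "\<not> P h'" if "\<And>a. a < j \<Longrightarrow> h a = h' a" "\<not> P h" for h h'
      using ext[of h' h] that by metis
  next
    fix f a v
    assume *: "incr j N f" "\<not> P f" "a < j" "incr j N (f(a := v))" "f a = Suc v"
    show "\<not> P (f(a := v))"
    proof
      assume "P (f(a := v))"
      moreover have "f(a := v, a := f a) = f" by simp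
      ultimately have "P f" using move[OF *(4) _ *(3), of "f a"] * by (metis fun_upd_same)
      then show False using * by blast
    qed
  qed (use f' \<open>\<not> P f'\<close> in blast)+
  ultimately show False by blast
qed

text \<open>A unit step can violate monotonicity only by colliding with a neighbour; the resulting
  minor then has two equal rows.\<close>

lemma incr_move:
  assumes f: "incr j N f" and "a < j" "v < N" "f a = Suc v \<or> v = Suc (f a)"
  shows "incr j N (f(a := v)) \<or> (\<exists>b<j. b \<noteq> a \<and> f b = v)"
proof (rule disjCI)
  assume *: "\<not> (\<exists>b<j. b \<noteq> a \<and> f b = v)"
  show "incr j N (f(a := v))"
  proof (rule incrI)
    fix b c assume bc: "b < c" "c < j"
    then have "b < j" by simp
    with bc have "b = a \<Longrightarrow> f c \<noteq> v" "c = a \<Longrightarrow> f b \<noteq> v" using * by blast+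
    then show "(f(a := v)) b < (f(a := v)) c"
      using incr_less[OF f bc] bc assms by auto
  qed (use assms incr_bound[OF f] in auto)
qed

text \<open>The operation acts on the whole matrix, hence on all minors through row \<open>u\<close>
  at once.\<close>

definition add_row :: "nat \<Rightarrow> nat \<Rightarrow> 'a::comm_ring_1 \<Rightarrow> (nat \<Rightarrow> nat \<Rightarrow> 'a) \<Rightarrow> nat \<Rightarrow> nat \<Rightarrow> 'a" where
  "add_row u v e A i l = (if i = u then A u l + e * A v l else A i l)"

text \<open>Linearity in row \<open>a\<close>; injectivity of \<open>f\<close> ensures that no other
  chosen row is altered.\<close>

lemma minor_add_row_in:
  assumes f: "incr j N f" and a: "a < j"
  shows "minor (add_row (f a) v e A) j f g = minor A j f g + e * minor A j (f(a := v)) g"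
proof -
  obtain j' where j: "j = Suc j'" using a by (cases j) auto
  have ne: "f (skip a i) \<noteq> f a" if "i < j'" for i
    using incr_inj[OF f, of "skip a i" a] that a j by (auto simp: skip_def split: if_splits)
  have 1: "minor (add_row (f a) v e A) j' (f \<circ> skip a) h = minor A j' (f \<circ> skip a) h" for h
    by (rule minor_cong) (use ne in \<open>auto simp: add_row_def\<close>)
  have 2: "f(a := v) \<circ> skip a = f \<circ> skip a" by (auto simp: skip_def)
  show ?thesis
    unfolding j using a j
    by (simp only: minor_expand_row[of a] less_Suc_eq_le 1 2)
       (simp add: add_row_def algebra_simps sum.distrib sum_distrib_left)
qed

lemma minor_add_row_notin:
  assumes "\<And>a. a < j \<Longrightarrow> f a \<noteq> u"
  shows "minor (add_row u v e A) j f g = minor A j f g"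
  by (rule minor_cong) (use assms in \<open>auto simp: add_row_def\<close>)

text \<open>Perturbation: as long as some minor on consecutive columns vanishes, adding a small multiple
  of a row to an adjacent row makes one more of them positive and keeps the others nonnegative. Once
  all of them are positive, \<open>fekete_strict\<close> applies.\<close>

lemma fekete_nonneg:
  fixes A :: "nat \<Rightarrow> nat \<Rightarrow> real"
  assumes nonneg: "\<And>j f l. j \<le> k \<Longrightarrow> incr j N f \<Longrightarrow> l + j \<le> M \<Longrightarrow> minor A j f (\<lambda>b. l + b) \<ge> 0"
    and rank: "\<And>j l. j \<le> k \<Longrightarrow> l + j \<le> M \<Longrightarrow> \<exists>f. incr j N f \<and> minor A j f (\<lambda>b. l + b) > 0"
    and j0: "j0 \<le> k" "incr j0 N f0" "incr j0 M g0"
  shows "minor A j0 f0 g0 \<ge> 0"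
proof (rule ccontr)
  \<comment> \<open>Extensional maps make the set of consecutive-column minors finite, so those not
    yet positive can be counted.\<close>
  define T where "T = {(j, f, l). j \<le> k \<and> l + j \<le> M \<and> incr j N f \<and> f \<in> {..<j} \<rightarrow>\<^sub>E {..<N}}"
  have T_iff: "(j, f, l) \<in> T \<longleftrightarrow> j \<le> k \<and> l + j \<le> M \<and> incr j N f \<and> f \<in> {..<j} \<rightarrow>\<^sub>E {..<N}" for j f l
    by (simp add: T_def)
  have "T \<subseteq> (SIGMA j:{..k}. ({..<j} \<rightarrow>\<^sub>E {..<N}) \<times> {..M})"
  proof
    fix x assume "x \<in> T"
    then show "x \<in> (SIGMA j:{..k}. ({..<j} \<rightarrow>\<^sub>E {..<N}) \<times> {..M})"
      by (cases x) (simp add: T_def)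
  qed
  then have fin: "finite T"
    by (rule finite_subset) (intro finite_SigmaI finite_cartesian_product finite_PiE finite_atMost finite_lessThan)
  define pos where "pos B = {(j, f, l) \<in> T. minor B j f (\<lambda>b. l + b) > 0}" for B :: "nat \<Rightarrow> nat \<Rightarrow> real"
  define bad where "bad B \<longleftrightarrow>
      (\<forall>j f l. j \<le> k \<longrightarrow> incr j N f \<longrightarrow> l + j \<le> M \<longrightarrow> minor B j f (\<lambda>b. l + b) \<ge> 0) \<and>
      (\<forall>j l. j \<le> k \<longrightarrow> l + j \<le> M \<longrightarrow> (\<exists>f. incr j N f \<and> minor B j f (\<lambda>b. l + b) > 0)) \<and>
      minor B j0 f0 g0 < 0" for B :: "nat \<Rightarrow> nat \<Rightarrow> real"
  assume "\<not> minor A j0 f0 g0 \<ge> 0"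
  then have "bad A" using nonneg rank by (simp add: bad_def)
  moreover have "\<not> bad B" for B
  proof (induction "card (T - pos B)" arbitrary: B rule: less_induct)
    case (less B)
    show ?case
    proof
      assume "bad B"
      then have nn: "\<And>j f l. j \<le> k \<Longrightarrow> incr j N f \<Longrightarrow> l + j \<le> M \<Longrightarrow> minor B j f (\<lambda>b. l + b) \<ge> 0"
        and rk: "\<And>j l. j \<le> k \<Longrightarrow> l + j \<le> M \<Longrightarrow> \<exists>f. incr j N f \<and> minor B j f (\<lambda>b. l + b) > 0"
        and neg: "minor B j0 f0 g0 < 0"
        by (auto simp: bad_def)
      show False
      proof (cases "\<exists>j f l. j \<le> k \<and> l + j \<le> M \<and> incr j N f \<and> \<not> minor B j f (\<lambda>b. l + b) > 0")
        case False
        have "minor B j0 f0 g0 > 0"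
        proof (rule fekete_strict[where k = k and N = N and M = M])
          show "minor B j f (\<lambda>b. l + b) > 0" if "j \<le> k" "incr j N f" "l + j \<le> M" for j f l
            by (rule ccontr, rule notE[OF False], intro exI conjI) (rule that | assumption)+
        qed (fact j0)+
        then show False using neg by simp
      next
        case True
        then obtain j f2 l where 2: "j \<le> k" "l + j \<le> M" "incr j N f2" "\<not> minor B j f2 (\<lambda>b. l + b) > 0"
          by (elim exE conjE)
        obtain f1 where 1: "incr j N f1" "minor B j f1 (\<lambda>b. l + b) > 0" using rk[OF 2(1,2)] by (elim exE conjE)
        \<comment> \<open>Along a path of unit moves from the rows \<open>f1\<close> to the rows
          \<open>f2\<close>, positivity is lost at some single move.\<close>
        have "\<exists>f a v. incr j N f \<and> minor B j f (\<lambda>b. l + b) > 0 \<and> a < j \<and> incr j N (f(a := v)) \<and>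
            (f a = Suc v \<or> v = Suc (f a)) \<and> \<not> minor B j (f(a := v)) (\<lambda>b. l + b) > 0"
        proof (rule ccontr)
          assume *: "\<not> ?thesis"
          have "minor B j f2 (\<lambda>b. l + b) > 0"
          proof (rule incr_connected[where P = "\<lambda>f. minor B j f (\<lambda>b. l + b) > 0" and f = f1 and N = N and j = j])
            fix f f' :: "nat \<Rightarrow> nat" assume "\<And>a. a < j \<Longrightarrow> f a = f' a" "minor B j f (\<lambda>b. l + b) > 0"
            then show "minor B j f' (\<lambda>b. l + b) > 0"
              using minor_cong[of j B f _ B f'] by metis
          next
            show "minor B j (f(a := v)) (\<lambda>b. l + b) > 0"
              if "incr j N f" "minor B j f (\<lambda>b. l + b) > 0" "a < j" "incr j N (f(a := v))"
                "f a = Suc v \<or> v = Suc (f a)" for f a v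
              by (rule ccontr, rule notE[OF *], intro exI conjI) (rule that | assumption)+
          qed (fact 1 2)+
          then show False using 2 by simp
        qed
        then obtain f a v where f: "incr j N f" "minor B j f (\<lambda>b. l + b) > 0" "a < j"
            "incr j N (f(a := v))" "f a = Suc v \<or> v = Suc (f a)" "\<not> minor B j (f(a := v)) (\<lambda>b. l + b) > 0"
          by (elim exE conjE)
        define u where "u = f a"
        have uN: "u < N" using incr_bound[OF f(1,3)] by (simp add: u_def)
        have uv: "v = Suc u \<or> u = Suc v" using f(5) by (auto simp: u_def)
        \<comment> \<open>Every minor is affine in \<open>e\<close>, so a small \<open>e\<close>
          keeps the negative minor negative.\<close>
        have new: "\<exists>y. \<forall>e. minor (add_row v u e B) i h g = minor B i h g + e * y" if "incr i N h" for i h g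
        proof (cases "\<exists>b<i. h b = v")
          case True
          then show ?thesis using minor_add_row_in[OF that] by blast
        next
          case False
          then show ?thesis by (intro exI[of _ 0]) (auto intro: minor_add_row_notin)
        qed
        \<comment> \<open>The change is \<open>e\<close> times the minor with row \<open>v\<close>
          replaced by \<open>u\<close>, which is nonnegative by hypothesis or zero by a repeated
          row.\<close>
        have mono: "minor (add_row v u e B) i h (\<lambda>b. m + b) \<ge> minor B i h (\<lambda>b. m + b)"
          if h: "incr i N h" "i \<le> k" "m + i \<le> M" and e: "e > 0" for i h m e
        proof (cases "\<exists>b<i. h b = v")
          case True
          then obtain b where b: "b < i" "h b = v" by blast
          have "minor B i (h(b := u)) (\<lambda>b. m + b) \<ge> 0"
            using incr_move[OF h(1) b(1) uN]
          proof
            assume "incr i N (h(b := u))"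
            then show ?thesis using nn h by blast
          next
            assume "\<exists>b'<i. b' \<noteq> b \<and> h b' = u"
            then obtain b' where "b' < i" "b' \<noteq> b" "h b' = u" by blast
            then have "minor B i (h(b := u)) (\<lambda>b. m + b) = 0" using b by (intro minor_eq_rows[of b i b']) auto
            then show ?thesis by simp
          qed (use uv b in auto)
          then show ?thesis using e by (simp add: minor_add_row_in[OF h(1) b(1), unfolded b(2)])
        next
          case False
          then show ?thesis by (subst minor_add_row_notin) auto
        qed
        obtain y where y: "\<And>e. minor (add_row v u e B) j0 f0 g0 = minor B j0 f0 g0 + e * y"
          using new[OF j0(2)] by blast
        obtain e where e: "e > 0" "minor (add_row v u e B) j0 f0 g0 < 0"
        proof
          define x where "x = minor B j0 f0 g0"
          \<comment> \<open>The change \<open>e * y\<close> is at most half of \<open>- x\<close>;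
            the \<open>+ 1\<close> avoids division by zero.\<close>
          define e where "e = - x / (2 * (\<bar>y\<bar> + 1))"
          have "x < 0" using neg by (simp add: x_def)
          then show "e > 0" unfolding e_def by (intro divide_pos_pos) auto
          have "e * y \<le> e * (\<bar>y\<bar> + 1)" using \<open>e > 0\<close> by (intro mult_left_mono) auto
          also have "\<dots> = - x / 2" by (simp add: e_def field_simps)
          finally show "minor (add_row v u e B) j0 f0 g0 < 0"
            using y \<open>x < 0\<close> by (simp add: x_def)
        qed
        let ?B = "add_row v u e B"
        have "bad ?B"
          unfolding bad_def
        proof (intro conjI allI impI)
          show "minor ?B i h (\<lambda>b. m + b) \<ge> 0" if "i \<le> k" "incr i N h" "m + i \<le> M" for i h m
            using mono[of i h m e] nn[of i h m] e that by linarith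
          show "\<exists>h. incr i N h \<and> minor ?B i h (\<lambda>b. m + b) > 0" if "i \<le> k" "m + i \<le> M" for i m
            using mono[of i _ m e] rk[of i m] e that by (meson less_le_trans)
        qed (fact e(2))
        moreover have "\<not> bad ?B"
        proof (rule less)
          \<comment> \<open>Restricted to \<open>{..<j}\<close> to be part of an element of
            \<open>T\<close>; its minor is the one that becomes positive.\<close>
          define f' where "f' = restrict (f(a := v)) {..<j}"
          have f'eq: "minor C j f' h = minor C j (f(a := v)) h" for C :: "nat \<Rightarrow> nat \<Rightarrow> real" and h
            by (rule minor_cong) (auto simp: f'_def)
          have "incr j N f'" using f(4) by (auto simp: f'_def incr_def strict_mono_on_def)
          then have T': "(j, f', l) \<in> T"
            using 2 f(3) by (auto simp: T_iff f'_def incr_bound PiE_iff dest: incr_bound)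
          have "minor ?B j (f(a := v)) (\<lambda>b. l + b) = minor B j (f(a := v)) (\<lambda>b. l + b) + e * minor B j f (\<lambda>b. l + b)"
            using minor_add_row_in[OF f(4,3), of u e B] by (simp add: u_def)
          moreover have "minor B j (f(a := v)) (\<lambda>b. l + b) \<ge> 0" using nn 2 f by blast
          ultimately have "minor ?B j (f(a := v)) (\<lambda>b. l + b) > 0"
            using e f(2) by (metis add_nonneg_pos mult_pos_pos)
          then have "(j, f', l) \<in> pos ?B" "(j, f', l) \<notin> pos B"
            using T' f(6) by (auto simp: pos_def f'eq)
          moreover have "pos B \<subseteq> pos ?B"
            using mono e(1) by (fastforce simp: pos_def T_iff intro: less_le_trans)
          ultimately have "T - pos ?B \<subset> T - pos B" using T' by auto
          then show "card (T - pos ?B) < card (T - pos B)"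
            using fin by (intro psubset_card_mono) auto
        qed
        ultimately show False by blast
      qed
    qed
  qed
  ultimately show False by blast
qed

section \<open>Polya frequency sequences and their deflation\<close>

definition toeplitz :: "(int \<Rightarrow> real) \<Rightarrow> nat \<Rightarrow> nat \<Rightarrow> real" where
  "toeplitz s i l = s (int i - int l)"

text \<open>Polya frequency sequence of order \<open>k\<close>: total positivity of order
  \<open>k\<close> of the infinite Toeplitz matrix, from which \<open>N\<close> and \<open>M\<close>
  cut out finite windows.\<close>

definition pf :: "nat \<Rightarrow> (int \<Rightarrow> real) \<Rightarrow> bool" where
  "pf k s \<longleftrightarrow> (\<forall>j N f M g. j \<le> k \<longrightarrow> incr j N f \<longrightarrow> incr j M g \<longrightarrow> minor (toeplitz s) j f g \<ge> 0)"

definition deflate :: "real \<Rightarrow> (int \<Rightarrow> real) \<Rightarrow> int \<Rightarrow> real" where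
  "deflate p s t = s t - p * s (t - 1)"

lemma pfD: "pf k s \<Longrightarrow> j \<le> k \<Longrightarrow> incr j N f \<Longrightarrow> incr j M g \<Longrightarrow> minor (toeplitz s) j f g \<ge> 0"
  unfolding pf_def by blast

lemma pf_mono: "pf k s \<Longrightarrow> j \<le> k \<Longrightarrow> pf j s"
  unfolding pf_def by (meson order_trans)

lemma incr_bound_mono: "incr j N f \<Longrightarrow> N \<le> N' \<Longrightarrow> incr j N' f"
  unfolding incr_def by auto

lemma minor_1: "minor A (Suc 0) f g = A (f 0) (g 0)"
  by (simp add: minor_expand_row[of 0])

lemma minor_2: "minor A 2 f g = A (f 0) (g 0) * A (f 1) (g 1) - A (f 0) (g 1) * A (f 1) (g 0)"
  using minor_expand_row[of 0 1 A f g]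
  by (simp add: numeral_2_eq_2 minor_1 skip_def)

lemma pf_nonneg:
  assumes "pf k s" "k \<ge> 1" "\<And>t. t \<le> 0 \<Longrightarrow> s t = 0"
  shows "s t \<ge> 0"
proof (cases "t \<le> 0")
  case False
  have "minor (toeplitz s) 1 (\<lambda>_. nat t) (\<lambda>_. 0) \<ge> 0"
    by (rule pfD[OF assms(1,2), of "Suc (nat t)" _ 1]) (auto simp: incr_def strict_mono_on_def)
  then show ?thesis using False by (simp add: minor_1 toeplitz_def)
qed (use assms in auto)

text \<open>Subtract from each column \<open>p\<close> times the next one: the geometric last row
  becomes zero except for its last entry, and in the columns before the last the other rows turn
  into those of the deflated sequence.\<close>

lemma minor_bordered:
  fixes s :: "int \<Rightarrow> real" and p c :: real and j :: nat and f :: "nat \<Rightarrow> nat"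
  assumes "p \<noteq> 0"
  defines "B \<equiv> \<lambda>a l'. if a < j then toeplitz s (f a) l' else c / p ^ l'"
  shows "minor B (Suc j) id (\<lambda>b. l + b) = c / p ^ (l + j) * minor (toeplitz (deflate p s)) j f (\<lambda>b. l + b)"
proof -
  \<comment> \<open>The column operations as a unipotent matrix, of determinant one.\<close>
  define U where "U = mat (Suc j) (Suc j) (\<lambda>(a, b). if a = b then 1 else if a = Suc b then - p else 0)"
  define C where "C a b = (if b < j then B a (l + b) - p * B a (l + Suc b) else B a (l + b))" for a b
  define Bm where "Bm = mat (Suc j) (Suc j) (\<lambda>(a, b). B a (l + b))"
  have "det U = 1"
    by (subst det_lower_triangular[of "Suc j"]) (auto simp: U_def prod_list_diag_prod)
  moreover have "Bm * U = mat (Suc j) (Suc j) (\<lambda>(a, b). C a b)"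
  proof (rule eq_matI)
    fix a b assume "a < dim_row (mat (Suc j) (Suc j) (\<lambda>(a, b). C a b))"
      "b < dim_col (mat (Suc j) (Suc j) (\<lambda>(a, b). C a b))"
    then have ab: "a < Suc j" "b < Suc j" by auto
    have "(\<Sum>i\<in>{0..<Suc j}. B a (l + i) * (if i = b then 1 else if i = Suc b then - p else 0))
        = (\<Sum>i\<in>{0..<Suc j}. (if i = b then B a (l + b) else 0) + (if i = Suc b then - p * B a (l + Suc b) else 0))"
      by (rule sum.cong) auto
    also have "\<dots> = C a b"
      using ab unfolding sum.distrib by (auto simp: C_def)
    finally show "(Bm * U) $$ (a, b) = mat (Suc j) (Suc j) (\<lambda>(a, b). C a b) $$ (a, b)"
      using ab by (simp add: scalar_prod_def Bm_def U_def)
  qed (simp_all add: Bm_def U_def)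
  ultimately have "det Bm = minor C (Suc j) id id"
    using det_mult[of Bm "Suc j" U] by (simp add: minor_def Bm_def U_def)
  also have "\<dots> = (\<Sum>b\<in>{j}. (-1) ^ (j + b) * minor C j (id \<circ> skip j) (id \<circ> skip b) * C (id j) (id b))"
    unfolding minor_expand_row[OF order_refl]
  proof (rule sum.mono_neutral_right)
    show "\<forall>b\<in>{..j} - {j}. (-1) ^ (j + b) * minor C j (id \<circ> skip j) (id \<circ> skip b) * C (id j) (id b) = 0"
      using assms by (auto simp: C_def B_def)
  qed auto
  also have "\<dots> = C j j * minor C j (id \<circ> skip j) (id \<circ> skip j)"
    by (simp flip: power_add mult_2)
  also have "minor C j (id \<circ> skip j) (id \<circ> skip j) = minor (toeplitz (deflate p s)) j f (\<lambda>b. l + b)"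
    by (rule minor_cong) (auto simp: C_def B_def skip_def toeplitz_def deflate_def algebra_simps)
  also have "C j j = c / p ^ (l + j)" by (simp add: C_def B_def)
  finally show ?thesis by (simp add: minor_def Bm_def)
qed

text \<open>Append row \<open>n\<close> to a minor of \<open>s\<close>: divided by \<open>p ^ n\<close>, its entry in column \<open>l\<close> tends to
  \<open>c / p ^ l\<close> as \<open>n\<close> grows, which gives the bordered matrix of \<open>minor_bordered\<close>.\<close>

lemma pf_deflate_consecutive:
  assumes s: "pf (Suc k) s" and p: "p > 0" and c: "c > 0"
    and lim: "(\<lambda>n. s (int n) / p ^ n) \<longlonglongrightarrow> c"
    and j: "j \<le> k" "incr j N f"
  shows "minor (toeplitz (deflate p s)) j f (\<lambda>b. l + b) \<ge> 0"
proof -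
  define B where "B a l' = (if a < j then toeplitz s (f a) l' else c / p ^ l')" for a l'
  \<comment> \<open>The cofactors along the appended row; they do not depend on
    \<open>n\<close>.\<close>
  define D where "D b = (-1) ^ (j + b) * minor (toeplitz s) j f ((\<lambda>b. l + b) \<circ> skip b)" for b
  have lim': "(\<lambda>n. s (int n - int m) / p ^ n) \<longlonglongrightarrow> c / p ^ m" for m
  proof (rule LIMSEQ_offset[of _ m])
    have "(\<lambda>n. s (int n) / p ^ n * (1 / p ^ m)) \<longlonglongrightarrow> c * (1 / p ^ m)"
      by (intro tendsto_intros lim)
    then show "(\<lambda>n. s (int (n + m) - int m) / p ^ (n + m)) \<longlonglongrightarrow> c / p ^ m"
      by (simp add: power_add)
  qed
  have "(\<lambda>n. \<Sum>b\<le>j. D b * (s (int n - int (l + b)) / p ^ n)) \<longlonglongrightarrow> (\<Sum>b\<le>j. D b * (c / p ^ (l + b)))"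
    by (intro tendsto_sum tendsto_mult tendsto_const lim')
  moreover have "eventually (\<lambda>n. (\<Sum>b\<le>j. D b * (s (int n - int (l + b)) / p ^ n)) \<ge> 0) sequentially"
  proof (rule eventually_sequentiallyI)
    fix n assume "N \<le> n"
    have "incr (Suc j) (Suc n) (f(j := n))"
    proof (rule incrI)
      fix a b assume "a < b" "b < Suc j"
      then show "(f(j := n)) a < (f(j := n)) b"
        using incr_less[OF j(2), of a b] incr_bound[OF j(2), of a] \<open>N \<le> n\<close> by (cases "b = j") auto
    next
      fix a assume "a < Suc j"
      then show "(f(j := n)) a < Suc n"
        using incr_bound[OF j(2), of a] \<open>N \<le> n\<close> by (cases "a = j") auto
    qed
    moreover have "incr (Suc j) (l + Suc j) (\<lambda>b. l + b)"
      by (rule incr_shift) auto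
    ultimately have "minor (toeplitz s) (Suc j) (f(j := n)) (\<lambda>b. l + b) \<ge> 0"
      using j by (intro pfD[OF s]) auto
    also have "minor (toeplitz s) (Suc j) (f(j := n)) (\<lambda>b. l + b)
        = (\<Sum>b\<le>j. D b * s (int n - int (l + b)))"
    proof -
      have "minor (toeplitz s) j (f(j := n) \<circ> skip j) h = minor (toeplitz s) j f h" for h
        by (rule minor_cong) (auto simp: skip_def)
      then show ?thesis by (simp add: minor_expand_row[OF order_refl] D_def toeplitz_def)
    qed
    finally show "(\<Sum>b\<le>j. D b * (s (int n - int (l + b)) / p ^ n)) \<ge> 0"
      using p by (simp add: sum_divide_distrib[symmetric] divide_nonneg_pos del: of_nat_add)
  qed
  ultimately have "(\<Sum>b\<le>j. D b * (c / p ^ (l + b))) \<ge> 0"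
    by (rule tendsto_lowerbound) simp
  also have "(\<Sum>b\<le>j. D b * (c / p ^ (l + b))) = minor B (Suc j) id (\<lambda>b. l + b)"
  proof -
    have "minor B j (id \<circ> skip j) h = minor (toeplitz s) j f h" for h
      by (rule minor_cong) (auto simp: skip_def B_def)
    then show ?thesis by (simp add: minor_expand_row[OF order_refl] D_def B_def)
  qed
  also have "\<dots> = c / p ^ (l + j) * minor (toeplitz (deflate p s)) j f (\<lambda>b. l + b)"
    using minor_bordered[of p j s f c l] p by (simp add: B_def[abs_def])
  finally have "0 \<le> c / p ^ (l + j) * minor (toeplitz (deflate p s)) j f (\<lambda>b. l + b)" .
  moreover have "c / p ^ (l + j) > 0" using p c by simp
  ultimately show ?thesis by (metis linorder_not_less mult_pos_neg)
qed

text \<open>Fekete's criterion also asks for a positive minor in every block of consecutive columns.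
  Rows shifted by the first index \<open>m\<close> with \<open>s (int m)\<close> nonzero give a
  triangular block with positive diagonal.\<close>

lemma pf_deflate:
  assumes s: "pf (Suc k) s" and zero: "\<And>t. t \<le> 0 \<Longrightarrow> s t = 0" and p: "p > 0" and c: "c > 0"
    and lim: "(\<lambda>n. s (int n) / p ^ n) \<longlonglongrightarrow> c"
  shows "pf k (deflate p s)"
  unfolding pf_def
proof (intro allI impI)
  fix j N f M g assume j: "j \<le> k" "incr j N f" "incr j M g"
  have "\<exists>n. s (int n) \<noteq> 0"
  proof (rule ccontr)
    assume "\<nexists>n. s (int n) \<noteq> 0"
    then have "(\<lambda>n. 0) \<longlonglongrightarrow> c" using lim by simp
    then show False using c by (simp add: LIMSEQ_const_iff)
  qed
  define m where "m = (LEAST n. s (int n) \<noteq> 0)"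
  have m: "s (int m) \<noteq> 0" unfolding m_def by (rule LeastI_ex) fact
  have below: "s t = 0" if "t < int m" for t
  proof (cases "t \<le> 0")
    case False
    then have "nat t < m" using that by auto
    then have "s (int (nat t)) = 0" unfolding m_def by (blast dest: not_less_Least)
    then show ?thesis using False by simp
  qed (rule zero)
  have "s (int m) \<ge> 0" by (rule pf_nonneg[OF s _ zero]) auto
  then have pos: "deflate p s (int m) > 0" using m below by (simp add: deflate_def)
  have below': "deflate p s t = 0" if "t < int m" for t
    using below that by (simp add: deflate_def)
  \<comment> \<open>Enough rows for the shift by \<open>m\<close> in every column block.\<close>
  define N' where "N' = max N (M + m)"
  show "minor (toeplitz (deflate p s)) j f g \<ge> 0"
  proof (rule fekete_nonneg[where k = k and N = N' and M = M])
    fix i h l assume "i \<le> k" "incr i N' h"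
    then show "minor (toeplitz (deflate p s)) i h (\<lambda>b. l + b) \<ge> 0"
      using pf_deflate_consecutive[OF s p c lim] by blast
  next
    fix i l assume i: "i \<le> k" "l + i \<le> M"
    define h where "h b = l + m + b" for b
    have "incr i N' h" unfolding h_def by (rule incr_shift) (use i in \<open>auto simp: N'_def\<close>)
    moreover have "minor (toeplitz (deflate p s)) i h (\<lambda>b. l + b) = deflate p s (int m) ^ i"
      unfolding minor_def
      by (subst det_lower_triangular[of i])
         (auto simp: h_def toeplitz_def prod_list_diag_prod intro!: below')
    ultimately show "\<exists>h. incr i N' h \<and> minor (toeplitz (deflate p s)) i h (\<lambda>b. l + b) > 0"
      using pos by (metis zero_less_power)
  qed (use j incr_bound_mono[OF j(2), of N'] in \<open>auto simp: N'_def\<close>)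
qed

section \<open>Cesaro means of sums of exponentials\<close>

text \<open>For \<open>u \<noteq> 1\<close> the geometric sums stay bounded, so division by
  \<open>M\<close> sends them to zero.\<close>

lemma cesaro_geometric:
  fixes u :: complex
  assumes "norm u \<le> 1"
  shows "(\<lambda>M. (\<Sum>t<M. u ^ t) / of_nat M) \<longlonglongrightarrow> (if u = 1 then 1 else 0)"
proof (cases "u = 1")
  case True
  have "eventually (\<lambda>M. (\<Sum>t<M. u ^ t) / of_nat M = 1) sequentially"
    using eventually_gt_at_top[of 0] by eventually_elim (simp add: True)
  then show ?thesis using True by (simp add: tendsto_eventually)
next
  case False
  have "norm ((\<Sum>t<M. u ^ t) / of_nat M) \<le> 2 / norm (u - 1) / real M" for M
  proof -
    have "norm (u ^ M - 1) \<le> norm (u ^ M) + norm (1::complex)" by (rule norm_triangle_ineq4)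
    also have "\<dots> \<le> 2" using assms by (simp add: norm_power power_le_one)
    finally have "norm (u ^ M - 1) / norm (u - 1) / real M \<le> 2 / norm (u - 1) / real M"
      by (intro divide_right_mono) auto
    then show ?thesis using False by (simp add: geometric_sum norm_divide norm_mult)
  qed
  then have "(\<lambda>M. (\<Sum>t<M. u ^ t) / of_nat M) \<longlonglongrightarrow> 0"
    by (intro tendsto_0_le[OF lim_const_over_n[of "2 / norm (u - 1)"], where K = 1]) auto
  then show ?thesis using False by simp
qed

lemma cesaro_exp_sum:
  fixes u c :: "'i \<Rightarrow> complex"
  assumes "finite I" "\<And>i. i \<in> I \<Longrightarrow> norm (u i) \<le> 1"
  shows "(\<lambda>M. (\<Sum>t<M. \<Sum>i\<in>I. c i * u i ^ t) / of_nat M) \<longlonglongrightarrow> (\<Sum>i\<in>I. if u i = 1 then c i else 0)"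
proof -
  have "(\<lambda>M. \<Sum>i\<in>I. c i * ((\<Sum>t<M. u i ^ t) / of_nat M)) \<longlonglongrightarrow> (\<Sum>i\<in>I. c i * (if u i = 1 then 1 else 0))"
    by (intro tendsto_sum tendsto_mult tendsto_const cesaro_geometric assms)
  moreover have "(\<Sum>i\<in>I. c i * ((\<Sum>t<M. u i ^ t) / of_nat M)) = (\<Sum>t<M. \<Sum>i\<in>I. c i * u i ^ t) / of_nat M" for M
    by (subst sum.swap) (simp add: sum_distrib_left sum_divide_distrib)
  moreover have "(\<Sum>i\<in>I. c i * (if u i = 1 then 1 else 0)) = (\<Sum>i\<in>I. if u i = 1 then c i else 0)"
    by (rule sum.cong) auto
  ultimately show ?thesis by simp
qed

text \<open>If no frequency equals 1, the Cesaro means of \<open>f\<close> vanish; as \<open>f \<ge> 0\<close>, so do those of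
  \<open>f\<close> twisted by any unimodular frequency, which however recover the coefficients.\<close>

lemma nonneg_exp_sum_has_one:
  fixes f :: "nat \<Rightarrow> real" and u c :: "'i \<Rightarrow> complex"
  assumes I: "finite I" "inj_on u I" and u: "\<And>i. i \<in> I \<Longrightarrow> norm (u i) \<le> 1"
    and f: "\<And>t. f t \<ge> 0" "\<And>t. complex_of_real (f t) = (\<Sum>i\<in>I. c i * u i ^ t)"
    and a: "a \<in> I" "c a \<noteq> 0" "norm (u a) = 1"
  shows "\<exists>i\<in>I. u i = 1"
proof (rule ccontr)
  assume *: "\<not> (\<exists>i\<in>I. u i = 1)"
  \<comment> \<open>Twisting by the conjugate turns the frequency \<open>u a\<close>, and by
    injectivity no other, into 1.\<close>
  define w where "w = cnj (u a)"
  have w: "norm w = 1" using a by (simp add: w_def)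
  have iff: "u i * w = 1 \<longleftrightarrow> i = a" if "i \<in> I" for i
  proof
    have uw: "u a * w = 1"
      using a(3) complex_norm_square[of "u a"] by (simp add: w_def)
    {
      assume "u i * w = 1"
      then have "u i = u a" using uw w by (metis mult_right_cancel norm_zero zero_neq_one)
      then show "i = a" using I(2) that a(1) by (simp add: inj_on_eq_iff)
    }
    show "i = a \<Longrightarrow> u i * w = 1" using uw by simp
  qed
  have "(\<lambda>M. (\<Sum>t<M. \<Sum>i\<in>I. c i * u i ^ t) / of_nat M) \<longlonglongrightarrow> (\<Sum>i\<in>I. if u i = 1 then c i else 0)"
    by (rule cesaro_exp_sum) (use I u in auto)
  also have "(\<Sum>i\<in>I. if u i = 1 then c i else 0) = 0"
    using * by (intro sum.neutral) auto
  finally have "(\<lambda>M. norm ((\<Sum>t<M. complex_of_real (f t)) / of_nat M)) \<longlonglongrightarrow> 0"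
    unfolding f(2)[symmetric] by (rule tendsto_norm_zero)
  \<comment> \<open>Nonnegativity of \<open>f\<close> and modulus 1 of \<open>w\<close> bound the
    twisted sum by the plain one.\<close>
  moreover have "norm ((\<Sum>t<M. \<Sum>i\<in>I. c i * (u i * w) ^ t) / of_nat M)
      \<le> norm ((\<Sum>t<M. complex_of_real (f t)) / of_nat M)" for M
  proof -
    have "(\<Sum>t<M. \<Sum>i\<in>I. c i * (u i * w) ^ t) = (\<Sum>t<M. complex_of_real (f t) * w ^ t)"
      unfolding f(2) by (simp add: sum_distrib_left sum_distrib_right power_mult_distrib mult_ac)
    also have "norm \<dots> \<le> (\<Sum>t<M. norm (complex_of_real (f t) * w ^ t))" by (rule norm_sum)
    also have "\<dots> = (\<Sum>t<M. f t)" using f(1) w by (simp add: norm_mult norm_power)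
    also have "\<dots> = norm (\<Sum>t<M. complex_of_real (f t))"
      using f(1) by (simp add: sum_nonneg flip: of_real_sum)
    finally show ?thesis by (simp add: norm_divide divide_right_mono)
  qed
  ultimately have "(\<lambda>M. (\<Sum>t<M. \<Sum>i\<in>I. c i * (u i * w) ^ t) / of_nat M) \<longlonglongrightarrow> 0"
    by (elim tendsto_0_le[where K = 1]) (simp del: of_real_sum)
  then have "0 = (\<Sum>i\<in>I. if u i * w = 1 then c i else 0)"
    by (rule LIMSEQ_unique, intro cesaro_exp_sum) (use I u w in \<open>auto simp: norm_mult\<close>)
  moreover have "(\<Sum>i\<in>I. if u i * w = 1 then c i else 0) = c a"
    using I a by (simp add: iff cong: sum.cong)
  ultimately show False using a(2) by simp
qed

section \<open>Exponential tails, the leading pole and one deflation step\<close>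

text \<open>The formula holds only from some index on, since deflation moves its start and a pole at
  0 affects only early terms. Nonzero coefficients say that every \<open>p i\<close> really
  occurs.\<close>

definition exp_tail :: "'i set \<Rightarrow> ('i \<Rightarrow> complex) \<Rightarrow> (int \<Rightarrow> real) \<Rightarrow> bool" where
  "exp_tail I p s \<longleftrightarrow> (\<exists>c m. (\<forall>i\<in>I. c i \<noteq> 0) \<and>
     (\<forall>t\<ge>m. complex_of_real (s (int t)) = (\<Sum>i\<in>I. c i * p i ^ t)))"

text \<open>Deflation multiplies \<open>c i\<close> by \<open>1 - p a / p i\<close>, which vanishes
  only for \<open>i = a\<close>.\<close>

lemma exp_tail_deflate:
  assumes s: "exp_tail I p s" and I: "finite I" "inj_on p I" "\<And>i. i \<in> I \<Longrightarrow> p i \<noteq> 0"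
    and a: "a \<in> I" "p a = complex_of_real q"
  shows "exp_tail (I - {a}) p (deflate q s)"
proof -
  obtain c m where c: "\<forall>i\<in>I. c i \<noteq> 0"
      "\<And>t. t \<ge> m \<Longrightarrow> complex_of_real (s (int t)) = (\<Sum>i\<in>I. c i * p i ^ t)"
    using s unfolding exp_tail_def by blast
  define c' where "c' i = c i * (1 - p a / p i)" for i
  have "c' i \<noteq> 0" if "i \<in> I - {a}" for i
    using that c(1) I a by (auto simp: c'_def inj_on_eq_iff)
  moreover have "complex_of_real (deflate q s (int t)) = (\<Sum>i\<in>I - {a}. c' i * p i ^ t)" if "t \<ge> Suc m" for t
  proof -
    obtain t' where t: "t = Suc t'" using \<open>t \<ge> Suc m\<close> by (cases t) auto
    have "complex_of_real (deflate q s (int t)) = of_real (s (int t)) - p a * of_real (s (int t'))"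
      by (simp add: deflate_def t a)
    also have "\<dots> = (\<Sum>i\<in>I. c i * p i ^ t - p a * (c i * p i ^ t'))"
      using that c(2)[of t] c(2)[of t'] by (simp only: t) (simp add: sum_subtractf sum_distrib_left)
    also have "\<dots> = (\<Sum>i\<in>I. c' i * p i ^ t)"
      using I by (intro sum.cong) (auto simp: c'_def t field_simps)
    also have "\<dots> = (\<Sum>i\<in>I - {a}. c' i * p i ^ t)"
      using I a by (intro sum.mono_neutral_right) (auto simp: c'_def)
    finally show ?thesis .
  qed
  ultimately show ?thesis unfolding exp_tail_def by blast
qed

text \<open>The tie-break by real part matters: a positive real pole of maximal modulus has the
  largest real part, so it can only be the leading one.\<close>

definition leading :: "'i set \<Rightarrow> ('i \<Rightarrow> complex) \<Rightarrow> 'i \<Rightarrow> bool" where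
  "leading I p a \<longleftrightarrow> finite I \<and> inj_on p I \<and> a \<in> I \<and>
     (\<forall>i\<in>I. p i \<noteq> 0 \<and> cmod (p i) \<le> cmod (p a) \<and> (cmod (p i) = cmod (p a) \<longrightarrow> Re (p i) \<le> Re (p a)))"

text \<open>With \<open>q\<close> the maximal modulus, scaling puts the frequencies into the closed
  unit disc; the shift by \<open>m\<close> is absorbed by the coefficients.\<close>

lemma exp_tail_normalize:
  assumes "exp_tail I p s" "\<And>i. i \<in> I \<Longrightarrow> p i \<noteq> 0" "q > 0"
  obtains c m where "\<And>i. i \<in> I \<Longrightarrow> c i \<noteq> 0"
    "\<And>t. complex_of_real (s (int (m + t)) / q ^ (m + t)) = (\<Sum>i\<in>I. c i * (p i / of_real q) ^ t)"
proof -
  obtain c m where c: "\<forall>i\<in>I. c i \<noteq> 0"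
      "\<And>t. t \<ge> m \<Longrightarrow> complex_of_real (s (int t)) = (\<Sum>i\<in>I. c i * p i ^ t)"
    using assms(1) unfolding exp_tail_def by blast
  show thesis
  proof (rule that)
    show "c i * (p i / of_real q) ^ m \<noteq> 0" if "i \<in> I" for i
      using that c(1) assms by auto
    show "complex_of_real (s (int (m + t)) / q ^ (m + t))
        = (\<Sum>i\<in>I. c i * (p i / of_real q) ^ m * (p i / of_real q) ^ t)" for t
      using c(2)[of "m + t"] assms(3)
      by (simp add: sum_divide_distrib power_add power_divide mult_ac)
  qed
qed

text \<open>Some scaled frequency is 1, so a pole equals the maximal modulus \<open>q\<close>; the
  tie-break gives \<open>q \<le> Re (p a)\<close>, hence equality.\<close>

lemma leading_positive:
  assumes s: "exp_tail I p s" and a: "leading I p a" and nonneg: "\<And>t. s t \<ge> 0"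
  shows "p a = complex_of_real (cmod (p a))"
proof -
  define q where "q = cmod (p a)"
  have a': "finite I" "inj_on p I" "a \<in> I" "\<And>i. i \<in> I \<Longrightarrow> p i \<noteq> 0" "\<And>i. i \<in> I \<Longrightarrow> cmod (p i) \<le> q"
      "\<And>i. i \<in> I \<Longrightarrow> cmod (p i) = q \<Longrightarrow> Re (p i) \<le> Re (p a)"
    using a by (auto simp: leading_def q_def)
  have q: "q > 0" using a' by (simp add: q_def)
  obtain c m where c: "\<And>i. i \<in> I \<Longrightarrow> c i \<noteq> 0"
      "\<And>t. complex_of_real (s (int (m + t)) / q ^ (m + t)) = (\<Sum>i\<in>I. c i * (p i / of_real q) ^ t)"
    using exp_tail_normalize[OF s a'(4) q] by blast
  have "\<exists>i\<in>I. p i / of_real q = 1"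
  proof (rule nonneg_exp_sum_has_one)
    show "complex_of_real (s (int (m + t)) / q ^ (m + t)) = (\<Sum>i\<in>I. c i * (p i / of_real q) ^ t)" for t
      by (rule c)
    show "s (int (m + t)) / q ^ (m + t) \<ge> 0" for t using nonneg q by simp
    show "norm (p i / of_real q) \<le> 1" if "i \<in> I" for i
      using a'(5)[OF that] q by (simp add: norm_divide)
    show "norm (p a / of_real q) = 1" using q by (simp add: norm_divide q_def[symmetric])
    show "inj_on (\<lambda>i. p i / of_real q) I" using a'(2) q by (auto simp: inj_on_def)
  qed (use a' c in auto)
  then obtain i where i: "i \<in> I" "p i = of_real q" using q by auto
  then have "q \<le> Re (p a)" using a'(6)[of i] q by simp
  then have "Re (p a) = cmod (p a)" using complex_Re_le_cmod[of "p a"] by (simp add: q_def)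
  then have "Im (p a) = 0" using cmod_power2[of "p a"] by simp
  then show ?thesis using \<open>Re (p a) = cmod (p a)\<close> by (simp add: complex_eq_iff)
qed

text \<open>Convergent partial sums would make the Cesaro means tend to zero, whereas they tend to
  the nonzero coefficient of \<open>p a\<close>.\<close>

lemma not_summable_leading:
  assumes s: "exp_tail I p s" and a: "leading I p a" and nonneg: "\<And>t. s t \<ge> 0"
    and q: "p a = complex_of_real q" "q > 0"
  shows "\<not> summable (\<lambda>n. s (int n) / q ^ n)"
proof
  assume "summable (\<lambda>n. s (int n) / q ^ n)"
  have a': "finite I" "inj_on p I" "a \<in> I" "\<And>i. i \<in> I \<Longrightarrow> p i \<noteq> 0" "\<And>i. i \<in> I \<Longrightarrow> cmod (p i) \<le> q"
    using a q by (auto simp: leading_def)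
  obtain c m where c: "\<And>i. i \<in> I \<Longrightarrow> c i \<noteq> 0"
      "\<And>t. complex_of_real (s (int (m + t)) / q ^ (m + t)) = (\<Sum>i\<in>I. c i * (p i / of_real q) ^ t)"
    using exp_tail_normalize[OF s a'(4) q(2)] by blast
  define f where "f t = s (int (m + t)) / q ^ (m + t)" for t
  have f: "complex_of_real (f t) = (\<Sum>i\<in>I. c i * (p i / of_real q) ^ t)" for t
    using c(2) by (simp add: f_def)
  have "summable f"
    using summable_ignore_initial_segment[OF \<open>summable _\<close>, of m] by (simp add: f_def[abs_def] add.commute)
  then have sums: "(\<lambda>M. \<Sum>t<M. f t) \<longlonglongrightarrow> suminf f" by (rule summable_LIMSEQ)
  have "(\<lambda>M. (\<Sum>t<M. f t) * (1 / real M)) \<longlonglongrightarrow> suminf f * 0"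
    by (intro tendsto_mult sums lim_const_over_n)
  then have "(\<lambda>M. complex_of_real ((\<Sum>t<M. f t) * (1 / real M))) \<longlonglongrightarrow> complex_of_real 0"
    by (intro tendsto_of_real) simp
  then have "(\<lambda>M. (\<Sum>t<M. \<Sum>i\<in>I. c i * (p i / of_real q) ^ t) / of_nat M) \<longlonglongrightarrow> 0"
    by (simp add: f)
  then have "0 = (\<Sum>i\<in>I. if p i / of_real q = 1 then c i else 0)"
    by (rule LIMSEQ_unique, intro cesaro_exp_sum) (use a' q in \<open>auto simp: norm_divide\<close>)
  moreover have "(\<Sum>i\<in>I. if p i / of_real q = 1 then c i else 0) = c a"
  proof -
    have "p i / of_real q = 1 \<longleftrightarrow> i = a" if "i \<in> I" for i
      using that a' q by (auto simp: inj_on_eq_iff simp flip: q(1))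
    then show ?thesis using a' by (simp cong: sum.cong)
  qed
  ultimately show False using c(1)[OF a'(3)] by simp
qed

text \<open>Log-concavity makes the ratios of successive terms nonincreasing. A single ratio below
  \<open>q\<close> would persist and give convergence by the ratio test, contrary to
  \<open>not_summable_leading\<close>.\<close>

lemma pf_deflate_nonneg:
  assumes pf: "pf 2 s" and zero: "\<And>t. t \<le> 0 \<Longrightarrow> s t = 0"
    and s: "exp_tail I p s" and a: "leading I p a" and q: "p a = complex_of_real q" "q > 0"
  shows "deflate q s t \<ge> 0"
proof (rule ccontr)
  have nonneg: "s t \<ge> 0" for t by (rule pf_nonneg[OF pf _ zero]) auto
  assume "\<not> ?thesis"
  then have lt: "s t < q * s (t - 1)" by (simp add: deflate_def)
  then have "s (t - 1) \<noteq> 0" using nonneg[of t] by auto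
  then have pos: "s (t - 1) > 0" "t > 1" using nonneg[of "t - 1"] zero[of "t - 1"] by force+
  define r where "r = s t / s (t - 1)"
  have r: "0 \<le> r" "r < q" using lt pos nonneg[of t] by (auto simp: r_def field_simps)
  have step: "s (int (Suc n)) \<le> r * s (int n)" if "n \<ge> nat t" for n
  proof -
    define f where "f i = (if i = 0 then nat t else Suc n)" for i :: nat
    have "minor (toeplitz s) 2 f id \<ge> 0"
    proof (rule pfD[OF pf])
      show "incr 2 (n + 2) f" "incr 2 2 id" using that by (auto intro!: incrI simp: f_def)
    qed auto
    then have "s (t - 1) * s (int (Suc n)) \<le> s t * s (int n)"
      using pos by (simp add: minor_2 toeplitz_def f_def add.commute)
    then show ?thesis using pos by (simp add: r_def field_simps)
  qed
  have "summable (\<lambda>n. s (int n) / q ^ n)"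
  proof (rule summable_ratio_test)
    show "r / q < 1" using r q by simp
    show "norm (s (int (Suc n)) / q ^ Suc n) \<le> r / q * norm (s (int n) / q ^ n)" if "n \<ge> nat t" for n
      using step[OF that] q nonneg by (simp add: divide_right_mono field_simps del: of_nat_Suc)
  qed
  then show False using not_summable_leading[OF s a nonneg q] by simp
qed

lemma pf_step:
  assumes pf: "pf (Suc k) s" "k \<ge> 1" and zero: "\<And>t. t \<le> 0 \<Longrightarrow> s t = 0"
    and s: "exp_tail I p s" and a: "leading I p a" and q: "p a = complex_of_real q" "q > 0"
  shows "pf k (deflate q s)"
proof -
  have a': "finite I" "inj_on p I" "a \<in> I" "\<And>i. i \<in> I \<Longrightarrow> p i \<noteq> 0" "\<And>i. i \<in> I \<Longrightarrow> cmod (p i) \<le> q"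
    using a q by (auto simp: leading_def)
  have nonneg: "s t \<ge> 0" for t by (rule pf_nonneg[OF pf(1) _ zero]) auto
  have pf2: "pf 2 s" by (rule pf_mono[OF pf(1)]) (use pf(2) in auto)
  note dnonneg = pf_deflate_nonneg[OF pf2 zero s a q]
  have d: "exp_tail (I - {a}) p (deflate q s)"
    by (rule exp_tail_deflate) (use s a' q in auto)
  \<comment> \<open>Another pole on the circle of radius \<open>q\<close> would force, by
    nonnegativity of the deflated sequence, a remaining pole equal to \<open>q\<close>; but
    \<open>p a\<close> has been removed.\<close>
  have strict: "cmod (p b) < q" if b: "b \<in> I - {a}" for b
  proof (rule ccontr)
    assume "\<not> ?thesis"
    then have pb: "cmod (p b) = q" using a'(5)[of b] b by auto
    obtain c m where c: "\<And>i. i \<in> I - {a} \<Longrightarrow> c i \<noteq> 0"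
        "\<And>t. complex_of_real (deflate q s (int (m + t)) / q ^ (m + t))
          = (\<Sum>i\<in>I - {a}. c i * (p i / of_real q) ^ t)"
      using exp_tail_normalize[OF d _ q(2)] a'(4) by blast
    have "\<exists>i\<in>I - {a}. p i / of_real q = 1"
    proof (rule nonneg_exp_sum_has_one)
      show "complex_of_real (deflate q s (int (m + t)) / q ^ (m + t))
          = (\<Sum>i\<in>I - {a}. c i * (p i / of_real q) ^ t)" for t by (rule c)
      show "deflate q s (int (m + t)) / q ^ (m + t) \<ge> 0" for t using dnonneg q by simp
      show "norm (p i / of_real q) \<le> 1" if "i \<in> I - {a}" for i
        using a'(5)[of i] that q by (simp add: norm_divide)
      show "norm (p b / of_real q) = 1" using q pb by (simp add: norm_divide)
      show "inj_on (\<lambda>i. p i / of_real q) (I - {a})" using a'(2) q by (auto simp: inj_on_def)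
    qed (use a' b c in auto)
    then obtain i where "i \<in> I - {a}" "p i = p a" using q by auto
    then show False using a' by (auto simp: inj_on_eq_iff)
  qed
  obtain c m where c: "\<And>i. i \<in> I \<Longrightarrow> c i \<noteq> 0"
      "\<And>t. complex_of_real (s (int (m + t)) / q ^ (m + t)) = (\<Sum>i\<in>I. c i * (p i / of_real q) ^ t)"
    using exp_tail_normalize[OF s a'(4) q(2)] by blast
  \<comment> \<open>By strict dominance only the term of \<open>p a\<close> survives.\<close>
  have "(\<lambda>t. \<Sum>i\<in>I. c i * (p i / of_real q) ^ t) \<longlonglongrightarrow> (\<Sum>i\<in>I. if i = a then c a else 0)"
  proof (rule tendsto_sum)
    fix i assume i: "i \<in> I"
    show "(\<lambda>t. c i * (p i / of_real q) ^ t) \<longlonglongrightarrow> (if i = a then c a else 0)"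
    proof (cases "i = a")
      case False
      then have "norm (p i / of_real q) < 1" using strict[of i] i q by (simp add: norm_divide)
      then have "(\<lambda>t. c i * (p i / of_real q) ^ t) \<longlonglongrightarrow> c i * 0"
        by (intro tendsto_intros LIMSEQ_power_zero)
      then show ?thesis using False by simp
    qed (use q in simp)
  qed
  then have lim: "(\<lambda>t. complex_of_real (s (int (m + t)) / q ^ (m + t))) \<longlonglongrightarrow> c a"
    unfolding c(2) using a' by simp
  have re: "(\<lambda>t. s (int (m + t)) / q ^ (m + t)) \<longlonglongrightarrow> Re (c a)"
    using tendsto_Re[OF lim] by simp
  have "(\<lambda>t. 0 :: real) \<longlonglongrightarrow> Im (c a)"
    using tendsto_Im[OF lim] by simp
  then have "Im (c a) = 0" by (simp add: LIMSEQ_const_iff)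
  then have "Re (c a) \<noteq> 0" using c(1)[OF a'(3)] by (auto simp: complex_eq_iff)
  moreover have "Re (c a) \<ge> 0"
    by (rule LIMSEQ_le_const[OF re]) (use nonneg q in auto)
  ultimately have "Re (c a) > 0" by simp
  moreover have "(\<lambda>t. s (int t) / q ^ t) \<longlonglongrightarrow> Re (c a)"
    by (rule LIMSEQ_offset[of _ m]) (use re in \<open>simp only: add.commute[of _ m]\<close>)
  ultimately show ?thesis
    using pf_deflate[of k s q "Re (c a)"] pf(1) zero q(2) by blast
qed

section \<open>Real zeros under iterated deflation\<close>

text \<open>This says that the rational function \<open>\<Sum>t. s t / z ^ t\<close>, whose poles are the
  \<open>p i\<close>, vanishes at \<open>z = x\<close>, also where the series diverges: otherwise its value would
  be an additional constant on the right.\<close>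

definition vanishes_at :: "'i set \<Rightarrow> ('i \<Rightarrow> complex) \<Rightarrow> (int \<Rightarrow> real) \<Rightarrow> real \<Rightarrow> bool" where
  "vanishes_at I p s x \<longleftrightarrow> (\<exists>d m. \<forall>T\<ge>m.
     complex_of_real (\<Sum>t\<le>T. s (int t) / x ^ t) = (\<Sum>i\<in>I. d i * (p i / of_real x) ^ T))"

text \<open>The partial sums \<open>S T\<close> become \<open>S T - q / x * S (T - 1)\<close>, which
  multiplies \<open>d i\<close> by \<open>1 - p a / p i\<close> and so removes
  \<open>a\<close>.\<close>

lemma vanishes_at_deflate:
  assumes v: "vanishes_at I p s x" and "s (- 1) = 0" "x > 0"
    and I: "finite I" "\<And>i. i \<in> I \<Longrightarrow> p i \<noteq> 0" "a \<in> I" "p a = complex_of_real q"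
  shows "vanishes_at (I - {a}) p (deflate q s) x"
proof -
  obtain d m where d: "\<And>T. T \<ge> m \<Longrightarrow>
      complex_of_real (\<Sum>t\<le>T. s (int t) / x ^ t) = (\<Sum>i\<in>I. d i * (p i / of_real x) ^ T)"
    using v unfolding vanishes_at_def by blast
  define d' where "d' i = d i * (1 - p a / p i)" for i
  have "complex_of_real (\<Sum>t\<le>T. deflate q s (int t) / x ^ t) = (\<Sum>i\<in>I - {a}. d' i * (p i / of_real x) ^ T)"
    if T: "T \<ge> Suc m" for T
  proof -
    obtain T' where T': "T = Suc T'" using T by (cases T) auto
    have "(\<Sum>t\<le>T. deflate q s (int t) / x ^ t)
        = (\<Sum>t\<le>T. s (int t) / x ^ t) - (\<Sum>t\<le>T. q * s (int t - 1) / x ^ t)"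
      by (simp only: deflate_def diff_divide_distrib sum_subtractf)
    \<comment> \<open>The index shift leaves over the term at -1, which is zero.\<close>
    also have "(\<Sum>t\<le>T. q * s (int t - 1) / x ^ t) = q / x * (\<Sum>t\<le>T'. s (int t) / x ^ t)"
      unfolding T' sum.atMost_Suc_shift using assms(2) by (simp add: sum_distrib_left)
    finally have "complex_of_real (\<Sum>t\<le>T. deflate q s (int t) / x ^ t)
        = (\<Sum>i\<in>I. d i * (p i / of_real x) ^ T) - p a / of_real x * (\<Sum>i\<in>I. d i * (p i / of_real x) ^ T')"
      using d[of T] d[of T'] T T' I(4) by (simp del: of_real_sum)
    also have "\<dots> = (\<Sum>i\<in>I. d i * (p i / of_real x) ^ T - p a / of_real x * (d i * (p i / of_real x) ^ T'))"
      by (simp only: sum_subtractf sum_distrib_left)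
    also have "\<dots> = (\<Sum>i\<in>I. d' i * (p i / of_real x) ^ T)"
      using I(2) \<open>x > 0\<close> by (intro sum.cong) (auto simp: d'_def T' field_simps)
    also have "\<dots> = (\<Sum>i\<in>I - {a}. d' i * (p i / of_real x) ^ T)"
      using I by (intro sum.mono_neutral_right) (auto simp: d'_def)
    finally show ?thesis .
  qed
  then show ?thesis unfolding vanishes_at_def by blast
qed

text \<open>With all poles below \<open>x\<close> in modulus the partial sums tend to zero, yet they
  stay above one positive term.\<close>

lemma not_vanishes_at:
  assumes v: "vanishes_at I p s x" and "x > 0" and nonneg: "\<And>t. s t \<ge> 0" and "s (int t0) \<noteq> 0"
    and "\<And>i. i \<in> I \<Longrightarrow> cmod (p i) < x"
  shows False
proof -
  obtain d m where d: "\<And>T. T \<ge> m \<Longrightarrow>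
      complex_of_real (\<Sum>t\<le>T. s (int t) / x ^ t) = (\<Sum>i\<in>I. d i * (p i / of_real x) ^ T)"
    using v unfolding vanishes_at_def by blast
  have "(\<lambda>T. \<Sum>i\<in>I. d i * (p i / of_real x) ^ T) \<longlonglongrightarrow> (\<Sum>i\<in>I. d i * 0)"
    using assms by (intro tendsto_intros LIMSEQ_power_zero) (auto simp: norm_divide)
  then have "(\<lambda>T. \<Sum>i\<in>I. d i * (p i / of_real x) ^ T) \<longlonglongrightarrow> complex_of_real 0"
    by simp
  then have "(\<lambda>T. complex_of_real (\<Sum>t\<le>T. s (int t) / x ^ t)) \<longlonglongrightarrow> complex_of_real 0"
    by (rule Lim_transform_eventually) (rule eventually_sequentiallyI[of m], simp only: d)
  then have lim: "(\<lambda>T. \<Sum>t\<le>T. s (int t) / x ^ t) \<longlonglongrightarrow> 0"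
    unfolding tendsto_of_real_iff .
  have "s (int t0) / x ^ t0 \<le> (\<Sum>t\<le>T. s (int t) / x ^ t)" if "T \<ge> t0" for T
    using nonneg \<open>x > 0\<close> that by (intro member_le_sum) auto
  then have "s (int t0) / x ^ t0 \<le> 0"
    using LIMSEQ_le_const[OF lim] by blast
  moreover have "s (int t0) / x ^ t0 > 0"
    using nonneg[of "int t0"] assms(2,4) by simp
  ultimately show False by simp
qed

text \<open>Otherwise \<open>s\<close> would be geometric starting from the value zero.\<close>

lemma deflate_nonzero:
  assumes "\<And>t. t \<le> 0 \<Longrightarrow> s t = 0" "\<exists>n. s (int n) \<noteq> 0"
  shows "\<exists>n. deflate q s (int n) \<noteq> 0"
proof (rule ccontr)
  assume *: "\<not> ?thesis"
  have "s (int n) = 0" for n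
  proof (induction n)
    case (Suc n)
    then show ?case using *[simplified, rule_format, of "Suc n"] by (simp add: deflate_def)
  qed (use assms in auto)
  then show False using assms by blast
qed

lemma leading_first:
  fixes p :: "nat \<Rightarrow> complex"
  assumes "a \<le> b" "inj_on p {a..b}" "\<And>i. i \<in> {a..b} \<Longrightarrow> p i \<noteq> 0"
    and ord: "\<And>i j. i \<in> {a..b} \<Longrightarrow> j \<in> {a..b} \<Longrightarrow> i < j \<Longrightarrow>
      cmod (p j) \<le> cmod (p i) \<and> (cmod (p i) = cmod (p j) \<longrightarrow> Re (p j) \<le> Re (p i))"
  shows "leading {a..b} p a"
proof -
  have "cmod (p i) \<le> cmod (p a) \<and> (cmod (p i) = cmod (p a) \<longrightarrow> Re (p i) \<le> Re (p a))"
    if "i \<in> {a..b}" for i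
  proof (cases "i = a")
    case False
    then show ?thesis using ord[of a i] that by simp
  qed simp
  then show ?thesis using assms(1-3) by (simp add: leading_def)
qed

text \<open>Each deflation costs one order of positivity and removes the leading pole; after
  \<open>k\<close> of them nonnegativity remains and \<open>p (a + k)\<close> leads. The bound
  \<open>a + k \<le> Suc b\<close> lets the poles run out, in which case no positive
  \<open>x\<close> can be a zero.\<close>

lemma pf_iterate:
  fixes p :: "nat \<Rightarrow> complex"
  assumes "pf (Suc k) s" and "\<And>t. t \<le> 0 \<Longrightarrow> s t = 0" and "\<exists>n. s (int n) \<noteq> 0"
    and "exp_tail {a..b} p s" and "inj_on p {a..b}" and "\<And>i. i \<in> {a..b} \<Longrightarrow> p i \<noteq> 0"
    and "\<And>i j. i \<in> {a..b} \<Longrightarrow> j \<in> {a..b} \<Longrightarrow> i < j \<Longrightarrow>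
      cmod (p j) \<le> cmod (p i) \<and> (cmod (p i) = cmod (p j) \<longrightarrow> Re (p j) \<le> Re (p i))"
    and "a + k \<le> Suc b"
  shows "(a + k \<le> b \<longrightarrow> p (a + k) = complex_of_real (cmod (p (a + k)))) \<and>
    (\<forall>x>0. vanishes_at {a..b} p s x \<longrightarrow> a + k \<le> b \<and> x \<le> cmod (p (a + k)))"
  using assms
proof (induction k arbitrary: a s)
  case (0 a s)
  have nonneg: "s t \<ge> 0" for t using pf_nonneg[OF 0(1) _ 0(2)] by auto
  have lead: "leading {a..b} p a" if "a \<le> b"
    by (rule leading_first[OF that 0(5-7)])
  have "a \<le> b \<and> x \<le> cmod (p a)" if x: "x > 0" "vanishes_at {a..b} p s x" for x
  proof (rule ccontr)
    \<comment> \<open>In this case every remaining pole, if there is any, has modulus below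
      \<open>x\<close>.\<close>
    assume *: "\<not> ?thesis"
    obtain t0 where "s (int t0) \<noteq> 0" using 0(3) by blast
    then show False
    proof (rule not_vanishes_at[OF x(2,1) nonneg])
      fix i assume i: "i \<in> {a..b}"
      then have "cmod (p i) \<le> cmod (p a)" using lead by (auto simp: leading_def)
      then show "cmod (p i) < x" using * i by auto
    qed
  qed
  then show ?case using leading_positive[OF 0(4) lead nonneg] by simp
next
  case (Suc k a s)
  have ab: "a \<le> b" using Suc.prems(8) by simp
  have nonneg: "s t \<ge> 0" for t using pf_nonneg[OF Suc.prems(1) _ Suc.prems(2)] by auto
  have lead: "leading {a..b} p a"
    by (rule leading_first[OF ab Suc.prems(5-7)])
  define q where "q = cmod (p a)"
  have q: "p a = complex_of_real q" "q > 0"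
    using leading_positive[OF Suc.prems(4) lead nonneg] Suc.prems(6)[of a] ab by (auto simp: q_def)
  have eq: "{a..b} - {a} = {Suc a..b}" by auto
  have "(Suc a + k \<le> b \<longrightarrow> p (Suc a + k) = complex_of_real (cmod (p (Suc a + k)))) \<and>
    (\<forall>x>0. vanishes_at {Suc a..b} p (deflate q s) x \<longrightarrow> Suc a + k \<le> b \<and> x \<le> cmod (p (Suc a + k)))"
  proof (rule Suc.IH)
    show "pf (Suc k) (deflate q s)"
      by (rule pf_step[OF Suc.prems(1) _ Suc.prems(2,4) lead q]) auto
    show "deflate q s t = 0" if "t \<le> 0" for t
      using that Suc.prems(2) by (simp add: deflate_def)
    show "\<exists>n. deflate q s (int n) \<noteq> 0"
      by (rule deflate_nonzero[OF Suc.prems(2,3)])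
    show "exp_tail {Suc a..b} p (deflate q s)"
      unfolding eq[symmetric]
      by (rule exp_tail_deflate[OF Suc.prems(4) _ Suc.prems(5,6) _ q(1)]) (use ab in auto)
    show "inj_on p {Suc a..b}" by (rule inj_on_subset[OF Suc.prems(5)]) auto
    show "p i \<noteq> 0" if "i \<in> {Suc a..b}" for i using that Suc.prems(6) by auto
    show "cmod (p j) \<le> cmod (p i) \<and> (cmod (p i) = cmod (p j) \<longrightarrow> Re (p j) \<le> Re (p i))"
      if "i \<in> {Suc a..b}" "j \<in> {Suc a..b}" "i < j" for i j
      using Suc.prems(7)[of i j] that by auto
    show "Suc a + k \<le> Suc b" using Suc.prems(8) by simp
  qed
  moreover have "vanishes_at {Suc a..b} p (deflate q s) x" if "x > 0" "vanishes_at {a..b} p s x" for x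
    unfolding eq[symmetric]
    by (rule vanishes_at_deflate[OF that(2) _ that(1) _ Suc.prems(6) _ q(1)]) (use ab Suc.prems(2) in auto)
  ultimately show ?case by simp
qed

section \<open>From submatrices indexed by sets to index maps\<close>

text \<open>Exactly \<open>a\<close> elements of the image lie below \<open>f a\<close>.\<close>

lemma pick_image_incr:
  assumes "incr j N f" "a < j"
  shows "pick (f ` {..<j}) a = f a"
proof -
  have "{x \<in> f ` {..<j}. x < f a} = f ` {..<a}"
  proof (intro equalityI subsetI)
    fix x assume "x \<in> {x \<in> f ` {..<j}. x < f a}"
    then obtain b where b: "b < j" "x = f b" "f b < f a" by auto
    then have "\<not> a \<le> b" using incr_less[OF assms(1), of a b] by (cases "a = b") auto
    then show "x \<in> f ` {..<a}" using b by auto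
  next
    fix x assume "x \<in> f ` {..<a}"
    then obtain b where "x = f b" "b < a" by auto
    then show "x \<in> {x \<in> f ` {..<j}. x < f a}" using assms incr_less[OF assms(1), of b a] by auto
  qed
  moreover have "inj_on f {..<a}"
    using incr_inj[OF assms(1)] assms(2) by (auto simp: inj_on_def)
  ultimately have "card {x \<in> f ` {..<j}. x < f a} = a" by (simp add: card_image)
  then show ?thesis using pick_card_in_set[of "f a" "f ` {..<j}"] assms(2) by auto
qed

lemma incr_pick:
  assumes "I \<subseteq> {..<N}" "card I = j"
  shows "incr j N (pick I)"
  using assms pick_mono[of _ I] pick_in_set[of _ I] by (intro incrI) auto

lemma det_submatrix_mat:
  assumes "I \<subseteq> {..<N}" "J \<subseteq> {..<N}" "card I = j" "card J = j"
  shows "det (submatrix (mat N N (\<lambda>(a, b). A a b)) I J) = minor A j (pick I) (pick J)"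
proof -
  have "{i. i < N \<and> i \<in> I} = I" "{i. i < N \<and> i \<in> J} = J" using assms by auto
  then have "submatrix (mat N N (\<lambda>(a, b). A a b)) I J = mat j j (\<lambda>(a, b). A (pick I a) (pick J b))"
    using assms incr_bound[OF incr_pick[OF assms(1,3)]] incr_bound[OF incr_pick[OF assms(2,4)]]
    by (intro eq_matI) (auto simp: submatrix_def)
  then show ?thesis by (simp add: minor_def)
qed

lemma pf_iff_toeplitz: "pf k g \<longleftrightarrow> (\<forall>N\<ge>k. k_positive_mat k (toeplitz_mat g 0 N))"
proof
  assume "pf k g"
  then show "\<forall>N\<ge>k. k_positive_mat k (toeplitz_mat g 0 N)"
    unfolding k_positive_mat_def
  proof (intro allI impI ballI, elim conjE)
    fix N j I J
    assume *: "pf k g" "j \<in> {1..k}" "I \<subseteq> {..<dim_row (toeplitz_mat g 0 N)}"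
      "J \<subseteq> {..<dim_col (toeplitz_mat g 0 N)}" "card I = j" "card J = j"
    then have sub: "I \<subseteq> {..<N}" "J \<subseteq> {..<N}" by (auto simp: toeplitz_mat_def)
    have "minor (toeplitz g) j (pick I) (pick J) \<ge> 0"
      using incr_pick[OF sub(1) *(5)] incr_pick[OF sub(2) *(6)] *(2) by (intro pfD[OF *(1)]) auto
    then show "0 \<le> det (submatrix (toeplitz_mat g 0 N) I J)"
      using det_submatrix_mat[OF sub *(5,6), of "toeplitz g"] by (simp add: toeplitz_mat_def toeplitz_def)
  qed
next
  assume *: "\<forall>N\<ge>k. k_positive_mat k (toeplitz_mat g 0 N)"
  show "pf k g"
    unfolding pf_def
  proof (intro allI impI)
    fix j N f M h assume j: "j \<le> k" and f: "incr j N f" and h: "incr j M h"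
    show "minor (toeplitz g) j f h \<ge> 0"
    proof (cases "j = 0")
      case False
      \<comment> \<open>Large enough for both index maps and for the size condition
        \<open>N \<ge> k\<close>. Order 0 is separate because \<open>k_positive_mat\<close> starts
        at order 1.\<close>
      define L where "L = max k (max N M)"
      have card: "card (f ` {..<j}) = j" "card (h ` {..<j}) = j"
        using incr_inj[OF f] incr_inj[OF h] by (auto intro!: card_image[THEN trans] simp: inj_on_def)
      have sub: "f ` {..<j} \<subseteq> {..<L}" "h ` {..<j} \<subseteq> {..<L}"
        using incr_bound[OF f] incr_bound[OF h] by (auto simp: L_def less_max_iff_disj)
      have kp: "k_positive_mat k (mat L L (\<lambda>(a, b). toeplitz g a b))"
        using *[rule_format, of L] by (simp add: toeplitz_mat_def toeplitz_def L_def)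
      have "0 \<le> det (submatrix (mat L L (\<lambda>(a, b). toeplitz g a b)) (f ` {..<j}) (h ` {..<j}))"
        using kp[unfolded k_positive_mat_def, rule_format, of j "f ` {..<j}" "h ` {..<j}"] sub card j False
        by simp
      also have "\<dots> = minor (toeplitz g) j (pick (f ` {..<j})) (pick (h ` {..<j}))"
        by (rule det_submatrix_mat) (use sub card in auto)
      also have "\<dots> = minor (toeplitz g) j f h"
        by (rule minor_cong) (simp add: pick_image_incr[OF f] pick_image_incr[OF h])
      finally show ?thesis .
    qed simp
  qed
qed

section \<open>Impulse response and residues from partial fractions\<close>

lemma finite_eventually_notin_at_infinity:
  fixes S :: "complex set"
  assumes "finite S"
  shows "\<forall>\<^sub>F z in at_infinity. z \<notin> S"
  unfolding eventually_at_infinity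
proof (intro exI[of _ "1 + (\<Sum>x\<in>S. norm x)"] allI impI notI)
  fix z assume "1 + (\<Sum>x\<in>S. norm x) \<le> norm z" "z \<in> S"
  then show False using member_le_sum[of z S norm] assms by simp
qed

text \<open>With \<open>w = 1 / z\<close> this is a power series vanishing on a punctured disc; once
  the earlier coefficients are zero, the next one is a limit at 0.\<close>

lemma laurent_coeff_zero:
  fixes c :: "nat \<Rightarrow> complex"
  assumes "\<forall>\<^sub>F z in at_infinity. (\<lambda>t. c t / z ^ Suc t) sums 0"
  shows "c t = 0"
proof -
  obtain R where R: "\<And>z. norm z \<ge> R \<Longrightarrow> (\<lambda>t. c t / z ^ Suc t) sums 0"
    using assms unfolding eventually_at_infinity by blast
  \<comment> \<open>For nonzero \<open>w\<close> below this radius, \<open>1 / w\<close> lies where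
    the expansion holds.\<close>
  define s where "s = 1 / (\<bar>R\<bar> + 1)"
  have s: "s > 0" by (simp add: s_def add_nonneg_pos)
  have pw: "(\<lambda>t. c t * w ^ t) sums 0" if "w \<noteq> 0" "norm w < s" for w
  proof -
    have "R \<le> \<bar>R\<bar> + 1" by simp
    also have "\<dots> \<le> 1 / norm w" using that by (simp add: s_def field_simps)
    finally have "(\<lambda>t. c t / (1 / w) ^ Suc t) sums 0"
      by (intro R) (simp add: norm_divide)
    then have "(\<lambda>t. (c t * w ^ t) * w) sums (0 * w)"
      by (simp add: power_divide mult_ac)
    then show ?thesis using that by (subst (asm) sums_mult2_iff) auto
  qed
  show ?thesis
  proof (induction t rule: less_induct)
    case (less t)
    have "(\<lambda>m. c (m + t) * w ^ m) sums 0" if "w \<noteq> 0" "norm w < s" for w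
    proof -
      have "(\<lambda>m. c (m + t) * w ^ (m + t)) sums 0"
        using pw[OF that] less by (subst sums_iff_shift) simp
      then have "(\<lambda>m. (c (m + t) * w ^ m) * w ^ t) sums (0 * w ^ t)"
        by (simp add: power_add mult_ac)
      then show ?thesis using that by (subst (asm) sums_mult2_iff) auto
    qed
    then have "((\<lambda>w::complex. 0 :: complex) \<longlongrightarrow> c (0 + t)) (at 0)"
      using powser_limit_0_strong[OF s, of "\<lambda>m. c (m + t)" "\<lambda>w. 0"] by simp
    then show ?case
      using tendsto_const_iff[of "at (0::complex)" 0 "c t"] by simp
  qed
qed

text \<open>For large \<open>z\<close> each fraction is a geometric series in
  \<open>p i / z\<close>; then Laurent coefficients are compared.\<close>

lemma impulse_response_partial_fractions:
  fixes p r :: "'i \<Rightarrow> complex"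
  assumes g: "has_impulse_response G g" and I: "finite I"
    and pf: "\<And>z. z \<notin> p ` I \<Longrightarrow> tf_eval G z = (\<Sum>i\<in>I. r i / (z - p i))"
  shows "complex_of_real (g (int (Suc t))) = (\<Sum>i\<in>I. r i * p i ^ t)"
proof -
  define c where "c t = complex_of_real (g (int (Suc t))) - (\<Sum>i\<in>I. r i * p i ^ t)" for t
  have "\<forall>\<^sub>F z in at_infinity. (\<lambda>t. complex_of_real (g (int (Suc t))) / z ^ Suc t) sums tf_eval G z"
    using g by (simp add: has_impulse_response_def)
  moreover have "\<forall>\<^sub>F z in at_infinity. (\<lambda>t. \<Sum>i\<in>I. r i * p i ^ t / z ^ Suc t) sums (\<Sum>i\<in>I. r i / (z - p i))"
    unfolding eventually_at_infinity
  proof (intro exI[of _ "1 + (\<Sum>i\<in>I. norm (p i))"] allI impI sums_sum)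
    fix z :: complex and i assume z: "1 + (\<Sum>i\<in>I. norm (p i)) \<le> norm z" and i: "i \<in> I"
    have "norm (p i) \<le> (\<Sum>i\<in>I. norm (p i))"
      using I i by (intro member_le_sum) auto
    then have lt: "norm (p i) < norm z" using z by simp
    then have nz: "z \<noteq> 0" "z \<noteq> p i" by auto
    have "norm (p i / z) < 1" using lt nz by (simp add: norm_divide)
    then have "(\<lambda>t. r i / z * (p i / z) ^ t) sums (r i / z * (1 / (1 - p i / z)))"
      by (intro sums_mult geometric_sums)
    also have "r i / z * (1 / (1 - p i / z)) = r i / (z - p i)"
      using nz by (simp add: field_simps)
    finally show "(\<lambda>t. r i * p i ^ t / z ^ Suc t) sums (r i / (z - p i))"
      by (simp add: power_divide mult_ac)
  qed
  moreover have "\<forall>\<^sub>F z in at_infinity. z \<notin> p ` I"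
    by (rule finite_eventually_notin_at_infinity) (use I in auto)
  ultimately have "\<forall>\<^sub>F z in at_infinity. (\<lambda>t. c t / z ^ Suc t) sums 0"
  proof eventually_elim
    case (elim z)
    from sums_diff[OF elim(1,2)] pf[OF elim(3)]
    show ?case by (simp add: c_def diff_divide_distrib sum_divide_distrib)
  qed
  then have "c t = 0" by (rule laurent_coeff_zero)
  then show ?thesis by (simp add: c_def)
qed

text \<open>Were the residue zero, the numerator would be the denominator times a function
  continuous at \<open>p i\<close>, and both would vanish there.\<close>

lemma residue_nonzero:
  fixes p r :: "'i \<Rightarrow> complex"
  assumes I: "finite I" "inj_on p I" and poles: "tf_poles G = p ` I"
    and pf: "\<And>z. z \<notin> p ` I \<Longrightarrow> tf_eval G z = (\<Sum>i\<in>I. r i / (z - p i))" and i: "i \<in> I"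
  shows "r i \<noteq> 0"
proof
  assume r: "r i = 0"
  define h where "h z = (\<Sum>j\<in>I - {i}. r j / (z - p j))" for z
  have ne: "p i - p j \<noteq> 0" if "j \<in> I - {i}" for j
    using that I i by (auto simp: inj_on_eq_iff)
  have "(poly (tf_num G) \<longlongrightarrow> poly (tf_den G) (p i) * h (p i)) (at (p i))"
  proof (rule Lim_transform_eventually)
    show "((\<lambda>z. poly (tf_den G) z * h z) \<longlongrightarrow> poly (tf_den G) (p i) * h (p i)) (at (p i))"
      unfolding h_def using ne
      by (intro tendsto_intros) auto
    have "\<forall>\<^sub>F z in at (p i). z \<notin> p ` I - {p i}"
    proof -
      have "open (- (p ` I - {p i}))" using I by (intro open_Compl finite_imp_closed) auto
      then show ?thesis unfolding eventually_at_topological by blast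
    qed
    then show "\<forall>\<^sub>F z in at (p i). poly (tf_den G) z * h z = poly (tf_num G) z"
      using eventually_neq_at_within[of "p i" "p i" UNIV]
    proof eventually_elim
      case (elim z)
      then have z: "z \<notin> p ` I" by auto
      then have "poly (tf_den G) z \<noteq> 0" using poles by (auto simp: tf_poles_def)
      then have "poly (tf_num G) z = poly (tf_den G) z * tf_eval G z" by (simp add: tf_eval_def)
      also have "tf_eval G z = h z"
        unfolding pf[OF z] h_def using I i r by (intro sum.mono_neutral_right) auto
      finally show ?case ..
    qed
  qed
  moreover have "(poly (tf_num G) \<longlongrightarrow> poly (tf_num G) (p i)) (at (p i))"
    by (intro tendsto_intros)
  ultimately have "poly (tf_num G) (p i) = poly (tf_den G) (p i) * h (p i)"
    by (intro tendsto_unique[of "at (p i)"]) auto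
  moreover have "p i \<in> tf_poles G" using poles i by auto
  ultimately show False using tf_poles_zeros_disjoint[of G] by (auto simp: tf_poles_def tf_zeros_def)
qed

section \<open>Deflation of the transfer function\<close>

lemma tf_den_nonzero: "tf_den G \<noteq> 0"
  unfolding tf_den_def by (simp add: map_poly_eq_0_iff)

text \<open>Cross-multiplication relates the reduced representation to any other, so reduced forms
  need not be computed.\<close>

lemma tf_num_den_fract:
  assumes "G = Fraction_Field.Fract a b" "b \<noteq> 0"
  shows "tf_num G * map_poly complex_of_real b = map_poly complex_of_real a * tf_den G"
proof -
  have "fst (quot_of_fract G) * b = a * snd (quot_of_fract G)"
    using assms eq_fract(1)[of "snd (quot_of_fract G)" b "fst (quot_of_fract G)" a] by simp
  then show ?thesis
    unfolding tf_num_def tf_den_def by (metis poly_map_of_real_hom(1))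
qed

context
  fixes G Gr :: transfer_function and q :: real
  assumes Gr: "Gr = Fraction_Field.Fract [:- q, 1:] [:0, 1:] * G"
begin

text \<open>The form without division accounts for a possible cancellation of the factors
  \<open>z\<close> and \<open>z - q\<close>.\<close>

lemma num_den_deflate: "tf_num Gr * (tf_den G * [:0, 1:]) = tf_num G * [:- of_real q, 1:] * tf_den Gr"
proof -
  define a b where "a = fst (quot_of_fract G)" and "b = snd (quot_of_fract G)"
  have "Gr = Fraction_Field.Fract [:- q, 1:] [:0, 1:] * Fraction_Field.Fract a b"
    unfolding Gr by (simp add: a_def b_def)
  then have "Gr = Fraction_Field.Fract ([:- q, 1:] * a) ([:0, 1:] * b)"
    by (simp only: mult_fract)
  moreover have "[:0, 1:] * b \<noteq> 0" by (simp add: b_def)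
  ultimately have "tf_num Gr * map_poly complex_of_real ([:0, 1:] * b)
      = map_poly complex_of_real ([:- q, 1:] * a) * tf_den Gr"
    by (rule tf_num_den_fract)
  then show ?thesis
    unfolding poly_map_of_real_hom a_def b_def
    by (simp add: tf_num_def[of G, symmetric] tf_den_def[of G, symmetric] map_poly_pCons mult_ac
        del: mult_pCons_left mult_pCons_right)
qed

lemma fract_deflate: "G = Fraction_Field.Fract [:0, 1:] [:- q, 1:] * Gr"
proof -
  have "Fraction_Field.Fract [:0, 1:] [:- q, 1:] * Fraction_Field.Fract [:- q, 1:] [:0, 1:]
      = Fraction_Field.Fract ([:0, 1:] * [:- q, 1:]) ([:- q, 1:] * [:0, 1:])"
    by (rule mult_fract)
  also have "\<dots> = 1"
    unfolding One_fract_def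
    by (subst eq_fract(1)) (simp_all add: mult.commute)
  finally show ?thesis unfolding Gr by (simp flip: mult.assoc)
qed

lemma tf_eval_deflate:
  assumes "z \<noteq> 0" "z \<notin> tf_poles G"
  shows "tf_eval Gr z = (1 - of_real q / z) * tf_eval G z"
proof -
  have G: "poly (tf_den G) z \<noteq> 0" using assms by (simp add: tf_poles_def)
  have eq: "poly (tf_num Gr) z * (poly (tf_den G) z * z) = poly (tf_num G) z * (z - of_real q) * poly (tf_den Gr) z"
    using arg_cong[OF num_den_deflate, of "\<lambda>f. poly f z"] by (simp add: algebra_simps)
  \<comment> \<open>A zero here would be a common zero of the reduced numerator and
    denominator.\<close>
  have "poly (tf_den Gr) z \<noteq> 0"
  proof
    assume "poly (tf_den Gr) z = 0"
    then have "poly (tf_num Gr) z = 0" using eq G assms by simp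
    then show False
      using \<open>poly (tf_den Gr) z = 0\<close> tf_poles_zeros_disjoint[of Gr] by (auto simp: tf_poles_def tf_zeros_def)
  qed
  then show ?thesis
    using eq G assms by (simp add: tf_eval_def field_simps)
qed

lemma has_impulse_response_deflate:
  assumes g: "has_impulse_response G g"
  shows "has_impulse_response Gr (deflate q g)"
  unfolding has_impulse_response_def
proof (intro conjI allI impI)
  have zero: "g t = 0" if "t \<le> 0" for t using g that by (simp add: has_impulse_response_def)
  then show "deflate q g t = 0" if "t \<le> 0" for t using that by (simp add: deflate_def)
  have "\<forall>\<^sub>F z in at_infinity. z \<notin> insert 0 (tf_poles G)"
    by (rule finite_eventually_notin_at_infinity)
      (use poly_roots_finite[OF tf_den_nonzero[of G]] in \<open>simp add: tf_poles_def\<close>)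
  moreover have "\<forall>\<^sub>F z in at_infinity. (\<lambda>t. complex_of_real (g (int (Suc t))) / z ^ Suc t) sums tf_eval G z"
    using g by (simp add: has_impulse_response_def)
  ultimately show "\<forall>\<^sub>F z in at_infinity. (\<lambda>t. complex_of_real (deflate q g (int (Suc t))) / z ^ Suc t) sums tf_eval Gr z"
  proof eventually_elim
    case (elim z)
    \<comment> \<open>Since \<open>g 0 = 0\<close>, the series may start at power 0; its multiple by
      \<open>q / z\<close> is then the shifted series.\<close>
    then have "(\<lambda>t. complex_of_real (g (int t)) / z ^ t) sums tf_eval G z"
      using sums_Suc[OF elim(2)] zero[of 0] by simp
    then have "(\<lambda>t. of_real q / z * (complex_of_real (g (int t)) / z ^ t)) sums (of_real q / z * tf_eval G z)"
      by (rule sums_mult)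
    from sums_diff[OF elim(2) this]
    have "(\<lambda>t. complex_of_real (g (int (Suc t))) / z ^ Suc t - of_real q / z * (complex_of_real (g (int t)) / z ^ t))
        sums ((1 - of_real q / z) * tf_eval G z)"
      by (simp add: algebra_simps)
    moreover have "complex_of_real (g (int (Suc t))) / z ^ Suc t - of_real q / z * (complex_of_real (g (int t)) / z ^ t)
        = complex_of_real (deflate q g (int (Suc t))) / z ^ Suc t" for t
      by (simp add: deflate_def diff_divide_distrib)
    ultimately show ?case using tf_eval_deflate[of z] elim(1) by simp
  qed
qed

lemma is_system_deflate:
  assumes "is_system G"
  shows "is_system Gr"
proof -
  obtain g B where g: "has_impulse_response G g" "\<And>t. \<bar>g t\<bar> \<le> B"
    using assms unfolding is_system_def by blast
  have G: "G \<noteq> 0" "degree (tf_num G) < degree (tf_den G)"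
    using assms by (auto simp: is_system_def strictly_proper_def)
  have "Gr \<noteq> 0" using fract_deflate G by auto
  then have "fst (quot_of_fract Gr) \<noteq> 0" "fst (quot_of_fract G) \<noteq> 0"
    using G(1) Fract_quot_of_fract[of Gr] Fract_quot_of_fract[of G] by (metis fract_collapse(1))+
  then have ne: "tf_num Gr \<noteq> 0" "tf_num G \<noteq> 0"
    by (simp_all add: tf_num_def map_poly_eq_0_iff)
  \<comment> \<open>Both extra factors have degree one, so the relative degree is unchanged.\<close>
  have "degree (tf_num Gr) + (degree (tf_den G) + 1) = degree (tf_num G) + 1 + degree (tf_den Gr)"
    using arg_cong[OF num_den_deflate, of degree] ne
    by (simp add: degree_mult_eq tf_den_nonzero del: mult_pCons_left mult_pCons_right)
  then have "strictly_proper Gr" using G(2) by (simp add: strictly_proper_def)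
  moreover have "\<bar>deflate q g t\<bar> \<le> B + \<bar>q\<bar> * B" for t
  proof -
    have "\<bar>deflate q g t\<bar> \<le> \<bar>g t\<bar> + \<bar>q\<bar> * \<bar>g (t - 1)\<bar>"
      unfolding deflate_def abs_mult[symmetric] by (rule abs_triangle_ineq4)
    also have "\<dots> \<le> B + \<bar>q\<bar> * B" by (intro add_mono mult_left_mono g) auto
    finally show ?thesis .
  qed
  ultimately show ?thesis
    using \<open>Gr \<noteq> 0\<close> tf_poles_zeros_disjoint has_impulse_response_deflate[OF g(1)]
    unfolding is_system_def by blast
qed

end

section \<open>The factorization and the bound on the real zeros\<close>

theorem theorem5:
  fixes G :: transfer_function
    and n k :: nat
    and p r :: "nat \<Rightarrow> complex"
  assumes "is_system G"
    and "inj_on p {1..n}"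
    and "tf_poles G = p ` {1..n}"
    and "\<forall>z. z \<notin> p ` {1..n} \<longrightarrow> tf_eval G z = (\<Sum>i = 1..n. r i / (z - p i))"
    and "\<forall>i\<in>{1..n}. \<forall>j\<in>{1..n}. i < j \<longrightarrow>
           cmod (p j) \<le> cmod (p i) \<and> (cmod (p i) = cmod (p j) \<longrightarrow> Re (p j) \<le> Re (p i))"
    and "2 \<le> k" and "k \<le> n"
    and "toeplitz_k_positive k G"
  shows "p 1 \<in> \<real> \<and>
    (\<exists>Gr. is_system Gr \<and>
       G = Fraction_Field.Fract [:0, 1:] [:- Re (p 1), 1:] * Gr \<and>
       toeplitz_k_positive (k - 1) Gr) \<and>
    p (min k n) \<in> \<real> \<and>
    (\<forall>x::real. complex_of_real x \<in> tf_zeros G \<longrightarrow> x < Re (p (min k n)))"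
proof -
  obtain g where g: "has_impulse_response G g" "pf k g"
    using assms(8) unfolding toeplitz_k_positive_def pf_iff_toeplitz by blast
  have zero: "g t = 0" if "t \<le> 0" for t using g(1) that by (simp add: has_impulse_response_def)
  have pf_eval: "tf_eval G z = (\<Sum>i\<in>{1..n}. r i / (z - p i))" if "z \<notin> p ` {1..n}" for z
    using assms(4) that by blast
  have gr: "complex_of_real (g (int (Suc t))) = (\<Sum>i\<in>{1..n}. r i * p i ^ t)" for t
    using impulse_response_partial_fractions[OF g(1) _ pf_eval] by simp
  have r: "r i \<noteq> 0" if "i \<in> {1..n}" for i
    using residue_nonzero[OF _ assms(2,3) pf_eval that] by simp
  have ord: "cmod (p j) \<le> cmod (p i) \<and> (cmod (p i) = cmod (p j) \<longrightarrow> Re (p j) \<le> Re (p i))"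
    if "i \<in> {1..n}" "j \<in> {1..n}" "i < j" for i j using assms(5) that by blast
  \<comment> \<open>By the ordering, a pole at 0 can only be the last one; it is left out of
    \<open>{1..b}\<close> because the deflation factors divide by the poles.\<close>
  define b where "b = (if p n = 0 then n - 1 else n)"
  have b: "n \<le> Suc b" "b \<le> n" "1 \<le> b" using assms(6,7) by (auto simp: b_def)
  have nz: "p i \<noteq> 0" if "i \<in> {1..b}" for i
  proof (cases "i = n")
    case True
    then show ?thesis using that assms(6,7) by (auto simp: b_def split: if_splits)
  next
    case False
    then have "i < n" using that b by auto
    then have "p i \<noteq> p n" using assms(2) that by (auto simp: inj_on_eq_iff)
    then show ?thesis using ord[of i n] that \<open>i < n\<close> by auto
  qed
  have drop: "(\<Sum>i\<in>{1..n}. c i * p i ^ t) = (\<Sum>i\<in>{1..b}. c i * p i ^ t)" if "t > 0" for c t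
  proof (rule sum.mono_neutral_right)
    show "\<forall>i\<in>{1..n} - {1..b}. c i * p i ^ t = 0"
    proof
      fix i assume "i \<in> {1..n} - {1..b}"
      then have "i = n" "b \<noteq> n" using b by auto
      then show "c i * p i ^ t = 0" using that by (auto simp: b_def split: if_splits)
    qed
  qed (use b in auto)
  \<comment> \<open>\<open>g t\<close> involves \<open>p i ^ (t - 1)\<close>, whence the division by
    \<open>p i\<close>; from \<open>t = 2\<close> on this exponent is positive and a pole at 0
    contributes nothing.\<close>
  have tail: "exp_tail {1..b} p g"
    unfolding exp_tail_def
  proof (intro exI[of _ "\<lambda>i. r i / p i"] exI[of _ 2] conjI allI impI ballI)
    show "r i / p i \<noteq> 0" if "i \<in> {1..b}" for i using nz r that b by auto
    fix t :: nat assume "t \<ge> 2"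
    then obtain u where t: "t = Suc u" "u > 0" by (cases t) auto
    have "complex_of_real (g (int t)) = (\<Sum>i\<in>{1..b}. r i * p i ^ u)"
      unfolding t(1) gr by (rule drop) (rule t)
    also have "\<dots> = (\<Sum>i\<in>{1..b}. r i / p i * p i ^ t)"
      by (rule sum.cong) (use nz in \<open>auto simp: t\<close>)
    finally show "complex_of_real (g (int t)) = (\<Sum>i\<in>{1..b}. r i / p i * p i ^ t)" .
  qed
  have inj: "inj_on p {1..b}" by (rule inj_on_subset[OF assms(2)]) (use b in auto)
  have ord': "cmod (p j) \<le> cmod (p i) \<and> (cmod (p i) = cmod (p j) \<longrightarrow> Re (p j) \<le> Re (p i))"
    if "i \<in> {1..b}" "j \<in> {1..b}" "i < j" for i j using ord that b by auto
  have lead: "leading {1..b} p 1" by (rule leading_first[OF b(3) inj nz ord'])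
  have nonneg: "g t \<ge> 0" for t by (rule pf_nonneg[OF g(2) _ zero]) (use assms(6) in auto)
  define q where "q = cmod (p 1)"
  have q: "p 1 = complex_of_real q" "q > 0"
    using leading_positive[OF tail lead nonneg] nz[of 1] b by (auto simp: q_def)
  define Gr where "Gr = Fraction_Field.Fract [:- q, 1:] [:0, 1:] * G"
  have "pf (k - 1) (deflate q g)"
    by (rule pf_step[OF _ _ zero tail lead q]) (use g assms(6) in auto)
  then have "toeplitz_k_positive (k - 1) Gr"
    unfolding toeplitz_k_positive_def
    using has_impulse_response_deflate[OF Gr_def g(1)] pf_iff_toeplitz by blast
  moreover have "is_system Gr" by (rule is_system_deflate[OF Gr_def assms(1)])
  moreover have "G = Fraction_Field.Fract [:0, 1:] [:- Re (p 1), 1:] * Gr"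
    using fract_deflate[OF Gr_def] q by simp
  moreover have ex: "\<exists>n. g (int n) \<noteq> 0"
  proof (rule ccontr)
    assume "\<not> ?thesis"
    then have "summable (\<lambda>n. g (int n) / q ^ n)" by simp
    then show False using not_summable_leading[OF tail lead nonneg q] by simp
  qed
  \<comment> \<open>Positivity of order \<open>k\<close> allows \<open>k - 1\<close> deflations,
    which expose \<open>p k\<close>.\<close>
  have iter: "(1 + (k - 1) \<le> b \<longrightarrow> p (1 + (k - 1)) = complex_of_real (cmod (p (1 + (k - 1))))) \<and>
    (\<forall>x>0. vanishes_at {1..b} p g x \<longrightarrow> 1 + (k - 1) \<le> b \<and> x \<le> cmod (p (1 + (k - 1))))"
    by (rule pf_iterate[OF _ zero ex tail inj nz ord']) (use g assms(6,7) b in auto)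
  have k: "1 + (k - 1) = k" "min k n = k" using assms(6,7) by auto
  \<comment> \<open>Beyond \<open>b\<close> there is only the pole \<open>p n = 0\<close>, which is
    real as well.\<close>
  have pk: "p k = complex_of_real (cmod (p k))"
  proof (cases "k \<le> b")
    case False
    then have "k = n" "b \<noteq> n" using assms(7) b by auto
    then show ?thesis by (auto simp: b_def split: if_splits)
  qed (use iter k in simp)
  moreover have "x < Re (p k)" if x: "complex_of_real x \<in> tf_zeros G" for x
  proof (rule ccontr)
    assume *: "\<not> x < Re (p k)"
    \<comment> \<open>Zeros and poles are disjoint, which turns \<open>x \<ge> cmod (p k)\<close>
      into a strict inequality.\<close>
    have npole: "complex_of_real x \<notin> p ` {1..n}"
      using x tf_poles_zeros_disjoint[of G] assms(3) by blast
    moreover have "p k \<in> p ` {1..n}" using assms(6,7) by auto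
    ultimately have "p k \<noteq> complex_of_real x" by metis
    then have "x \<noteq> cmod (p k)" using pk by metis
    moreover have "Re (p k) = cmod (p k)" using pk by (metis Re_complex_of_real)
    ultimately have gt: "x > cmod (p k)" using * by simp
    then have "x > 0" using norm_ge_zero[of "p k"] by linarith
    have G0: "(\<Sum>i\<in>{1..n}. r i / (of_real x - p i)) = 0"
      using pf_eval[OF npole] x by (simp add: tf_eval_def tf_zeros_def)
    have ne: "complex_of_real x - p i \<noteq> 0" if "i \<in> {1..n}" for i
      using npole that by auto
    \<comment> \<open>For each pole the geometric sum is
      \<open>r i / (x - p i) * (1 - (p i / x) ^ T)\<close>; the constant parts add up to the value
      of \<open>G\<close> at \<open>x\<close>, which is zero.\<close>
    have partial: "complex_of_real (\<Sum>t\<le>T. g (int t) / x ^ t)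
        = (\<Sum>i\<in>{1..n}. - r i / (of_real x - p i) * (p i / of_real x) ^ T)" for T
    proof (induction T)
      case 0
      then show ?case using G0 zero[of 0] by (simp add: sum_negf)
    next
      case (Suc T)
      have "complex_of_real (\<Sum>t\<le>Suc T. g (int t) / x ^ t)
          = (\<Sum>i\<in>{1..n}. - r i / (of_real x - p i) * (p i / of_real x) ^ T) + of_real (g (int (Suc T))) / of_real x ^ Suc T"
        unfolding Suc.IH[symmetric] by simp
      also have "\<dots> = (\<Sum>i\<in>{1..n}. - r i / (of_real x - p i) * (p i / of_real x) ^ T + r i * p i ^ T / of_real x ^ Suc T)"
        unfolding gr sum_divide_distrib sum.distrib ..
      also have "\<dots> = (\<Sum>i\<in>{1..n}. - r i / (of_real x - p i) * (p i / of_real x) ^ Suc T)"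
        using ne \<open>x > 0\<close> by (intro sum.cong) (auto simp: field_simps)
      finally show ?case .
    qed
    have "vanishes_at {1..b} p g x"
      unfolding vanishes_at_def
    proof (intro exI[of _ "\<lambda>i. - r i / (of_real x - p i)"] exI[of _ 1] allI impI)
      \<comment> \<open>From \<open>T = 1\<close> on, the term of a pole at 0 disappears.\<close>
      fix T :: nat assume "T \<ge> 1"
      then show "complex_of_real (\<Sum>t\<le>T. g (int t) / x ^ t)
          = (\<Sum>i\<in>{1..b}. - r i / (of_real x - p i) * (p i / of_real x) ^ T)"
        using drop[of T "\<lambda>i. - r i / (of_real x - p i) / of_real x ^ T"]
        unfolding partial by (simp add: power_divide)
    qed
    then show False using iter k \<open>x > 0\<close> gt by fastforce
  qed
  moreover have "p 1 \<in> \<real>" "p k \<in> \<real>" using q(1) pk by (metis Reals_of_real)+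
  ultimately show ?thesis unfolding k by blast
qed

end
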